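(* There exists $k_0$ such that for every even integer $k \geq k_0$ we have $\underset{\sim}{Q}(\Phi_{(k/2,k/2)}) = 2$, i.e. $\lim_{n\to\infty} Q(\Phi_{(k/2,k/2)}^{\boxtimes n})^{1/n} = 2$.
   Context: A $k$-graph is a tuple of finite sets $V_1,\ldots,V_k$ together with a subset $\Phi \subseteq V_1\times\cdots\times V_k$. A subset $\Psi\subseteq\Phi$ is induced if $\Psi = \Phi\cap(\Psi_1\times\cdots\times\Psi_k)$, where $\Psi_i=\{a_i : a\in\Psi\}$; it is a matching if any two distinct $a,b\in\Psi$ satisfy $a_i\neq b_i$ for all $i\in[k]$. The subrank $Q(\Phi)$ is the maximum size of an induced matching $\Psi\subseteq\Phi$. The Kronecker product of $\Phi\subseteq V_1\times\cdots\times V_k$ and $\Psi\subseteq W_1\times\cdots\times W_k$ is $\Phi\boxtimes\Psi=\{((a_1,b_1),\ldots,(a_k,b_k)) : a\in\Phi, b\in\Psi\}\subseteq (V_1\times W_1)\times\cdots\times(V_k\times W_k)$, and $\Phi^{\boxtimes n}$ is the $n$-fold power. The asymptotic subrank is $\underset{\sim}{Q}(\Phi)=\lim_{n\to\infty}Q(\Phi^{\boxtimes n})^{1/n}$ (this limit exists and equals $\sup_n Q(\Phi^{\boxtimes n})^{1/n}$). For even $k$, $\Phi_{(k/2,k/2)}\subseteq[2]^k$ (with $V_1=\cdots=V_k=\{1,2\}$) is the set of $s\in\{1,2\}^k$ having exactly $k/2$ coordinates equal to $1$ and $k/2$ coordinates equal to $2$. *)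

theory Defs
  imports Complex_Main
begin

text \<open>
  A tuple of \<open>k\<close> sets is a list of length \<open>k\<close>, and \<open>V\<^sub>1 \<times> \<dots> \<times> V\<^sub>k\<close> is \<^term>\<open>listset V\<close>;
  coordinates are numbered from 0. All vertex sets of one \<open>k\<close>-graph share a type.
\<close>

record 'a kgraph =
  verts :: "'a set list"
  edges :: "'a list set"

definition is_kgraph :: "nat \<Rightarrow> 'a kgraph \<Rightarrow> bool" where
  "is_kgraph k G \<longleftrightarrow>
     length (verts G) = k \<and> (\<forall>A \<in> set (verts G). finite A) \<and> edges G \<subseteq> listset (verts G)"

abbreviation arity :: "'a kgraph \<Rightarrow> nat" where
  "arity G \<equiv> length (verts G)"

definition proj :: "nat \<Rightarrow> 'a list set \<Rightarrow> 'a set" where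
  "proj i \<Psi> = (\<lambda>a. a ! i) ` \<Psi>"

definition induced :: "'a kgraph \<Rightarrow> 'a list set \<Rightarrow> bool" where
  "induced G \<Psi> \<longleftrightarrow> \<Psi> = edges G \<inter> listset (map (\<lambda>i. proj i \<Psi>) [0..<arity G])"

definition matching :: "'a kgraph \<Rightarrow> 'a list set \<Rightarrow> bool" where
  "matching G \<Psi> \<longleftrightarrow> (\<forall>a\<in>\<Psi>. \<forall>b\<in>\<Psi>. a \<noteq> b \<longrightarrow> (\<forall>i<arity G. a ! i \<noteq> b ! i))"

definition subrank :: "'a kgraph \<Rightarrow> nat" where
  "subrank G = Max {card \<Psi> | \<Psi>. \<Psi> \<subseteq> edges G \<and> induced G \<Psi> \<and> matching G \<Psi>}"

definition kron :: "'a kgraph \<Rightarrow> 'b kgraph \<Rightarrow> ('a \<times> 'b) kgraph" where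
  "kron G H = \<lparr>verts = map2 (\<times>) (verts G) (verts H),
               edges = {zip a b | a b. a \<in> edges G \<and> b \<in> edges H}\<rparr>"

definition relabel :: "('a \<Rightarrow> 'b) \<Rightarrow> 'a kgraph \<Rightarrow> 'b kgraph" where
  "relabel f G = \<lparr>verts = map ((`) f) (verts G), edges = map f ` edges G\<rparr>"

text \<open>
  The vertices of the \<open>n\<close>-fold power are \<open>n\<close>-tuples, encoded as lists of length \<open>n\<close>, so that all
  powers have the same type: the injective relabelling \<open>(x, xs) \<mapsto> x # xs\<close> identifies
  \<open>V \<times> V\<^sup>n\<close> with \<open>V\<^bsup>n+1\<^esup>\<close>. The 0-th power is the one-edge \<open>k\<close>-graph.
\<close>

primrec kron_power :: "'a kgraph \<Rightarrow> nat \<Rightarrow> 'a list kgraph" where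
  "kron_power G 0 = \<lparr>verts = replicate (arity G) {[]}, edges = {replicate (arity G) []}\<rparr>"
| "kron_power G (Suc n) = relabel (\<lambda>(x, xs). x # xs) (kron G (kron_power G n))"

definition asymptotic_subrank :: "'a kgraph \<Rightarrow> real" where
  "asymptotic_subrank G = lim (\<lambda>n. root n (real (subrank (kron_power G n))))"

definition balanced_kgraph :: "nat \<Rightarrow> nat kgraph" where
  "balanced_kgraph k =
     \<lparr>verts = replicate k {1, 2},
      edges = {s \<in> listset (replicate k {1, 2}).
                 count_list s 1 = k div 2 \<and> count_list s 2 = k div 2}\<rparr>"

lemma in_listset_iff: "a \<in> listset V \<longleftrightarrow> list_all2 (\<in>) a V"
  by (induction V arbitrary: a) (auto simp: set_Cons_def list_all2_Cons2)

lemma finite_listset: "(\<And>A. A \<in> set V \<Longrightarrow> finite A) \<Longrightarrow> finite (listset V)"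
proof (induction V)
  case (Cons A V)
  have "listset (A # V) = (\<lambda>(x, xs). x # xs) ` (A \<times> listset V)"
    by (auto simp: set_Cons_def)
  with Cons show ?case by simp
qed simp

lemma is_kgraph_finite_edges: "is_kgraph k G \<Longrightarrow> finite (edges G)"
  unfolding is_kgraph_def by (meson finite_listset finite_subset)

lemma is_kgraph_balanced: "is_kgraph k (balanced_kgraph k)"
  by (auto simp: is_kgraph_def balanced_kgraph_def)

lemma is_kgraph_kron:
  assumes "is_kgraph k G" "is_kgraph k H"
  shows "is_kgraph k (kron G H)"
  using assms
  by (fastforce simp: is_kgraph_def kron_def in_listset_iff list_all2_conv_all_nth set_zip)

lemma is_kgraph_relabel: "is_kgraph k G \<Longrightarrow> is_kgraph k (relabel f G)"
  by (fastforce simp: is_kgraph_def relabel_def in_listset_iff list_all2_conv_all_nth)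

lemma is_kgraph_kron_power: "is_kgraph k G \<Longrightarrow> is_kgraph k (kron_power G n)"
proof (induction n)
  case 0
  then show ?case by (auto simp: is_kgraph_def in_listset_iff list_all2_conv_all_nth)
next
  case (Suc n)
  then show ?case by (simp add: is_kgraph_kron is_kgraph_relabel)
qed

lemma subrank_attained:
  assumes "is_kgraph k G" "k > 0"
  shows "\<exists>\<Psi>. \<Psi> \<subseteq> edges G \<and> induced G \<Psi> \<and> matching G \<Psi> \<and> card \<Psi> = subrank G"
    and "\<lbrakk>\<Psi> \<subseteq> edges G; induced G \<Psi>; matching G \<Psi>\<rbrakk> \<Longrightarrow> card \<Psi> \<le> subrank G"
proof -
  let ?S = "{card \<Psi> | \<Psi>. \<Psi> \<subseteq> edges G \<and> induced G \<Psi> \<and> matching G \<Psi>}"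
  have "?S \<subseteq> card ` Pow (edges G)" by auto
  then have fin: "finite ?S"
    by (rule finite_subset) (simp add: is_kgraph_finite_edges[OF assms(1)])
  have "listset (map (\<lambda>i. proj i {}) [0..<arity G]) = {}"
    using assms by (simp add: is_kgraph_def upt_conv_Cons proj_def set_Cons_def del: length_greater_0_conv)
  then have "induced G {}" "matching G {}"
    by (auto simp: induced_def matching_def)
  then have "?S \<noteq> {}" by auto
  with fin have "Max ?S \<in> ?S" by (rule Max_in)
  then show "\<exists>\<Psi>. \<Psi> \<subseteq> edges G \<and> induced G \<Psi> \<and> matching G \<Psi> \<and> card \<Psi> = subrank G"
    unfolding subrank_def by auto
  show "\<lbrakk>\<Psi> \<subseteq> edges G; induced G \<Psi>; matching G \<Psi>\<rbrakk> \<Longrightarrow> card \<Psi> \<le> subrank G"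
    unfolding subrank_def using fin by (intro Max_ge) auto
qed

end

theory Submission
  imports Defs "HOL-Library.FuncSet" "HOL-Library.Function_Algebras" "HOL-Analysis.Convex"
begin

text \<open>
  Write \<open>k = 2h\<close>, \<open>N = (2h choose h)\<close> and let \<open>\<mu>\<close> satisfy \<open>\<mu>\<^bsup>2h-2\<^esup> = N/2\<close>. Edges of the \<open>n\<close>-th power
  are \<open>n\<close>-tuples of \<open>h\<close>-subsets of the players. Player \<open>i\<close> keeps a vertex \<open>x\<close> if its random
  affine hash, with values in \<open>\<int>\<^sup>m\<close>, lands in a set of lattice points on a sphere in a box of side
  \<open>d\<close>. The vertices of an edge sum to a constant, so by strict convexity all players see the same
  hash value on a surviving edge. Surviving edges that share no vertex with another surviving edge
  form an induced matching.

  Two edges sharing a vertex collide with probability \<open>d\<^bsup>-mr\<^esup>\<close>, where \<open>r\<close> is the rank of their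
  difference matrix. So it suffices that, for every rank \<open>r\<close> space \<open>L\<close> of sum-zero vectors that
  vanish at some coordinate, at most \<open>N \<mu>\<^sup>r\<close> pairs of \<open>h\<close>-sets have their difference in \<open>L\<close>; then
  \<open>d\<^sup>m \<approx> \<mu>\<^sup>n\<close> leaves about \<open>2\<^sup>n\<close> edges. Merging two coordinates that are negatively correlated on
  \<open>L\<close> does not decrease the number of pairs, and this reduces the claim to the space of all
  sum-zero vectors supported on \<open>q = r + 1\<close> coordinates. For that space the number of pairs is
  log-convex in \<open>q\<close> along even \<open>q\<close> (Cauchy--Schwarz), so only \<open>q = 2\<close> and \<open>q = 2h - 2\<close> have to be
  checked by hand.
\<close>


subsection \<open>Ternary vectors in spaces of sum-zero vectors\<close>

text \<open>Coordinates are players. Indexing by all of \<open>nat\<close> lets a space and its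
  merged image, which has a smaller support, live in one vector space.\<close>

interpretation fvs: vector_space "\<lambda>(c::real) (v::nat \<Rightarrow> real) i. c * v i"
  by unfold_locales (auto simp: fun_eq_iff algebra_simps)

lemma sum_fun_apply: "(\<Sum>a\<in>A. f a) i = (\<Sum>a\<in>A. f a i)"
  for f :: "'b \<Rightarrow> 'c \<Rightarrow> real"
  by (induction A rule: infinite_finite_induct) auto

definition fsupp :: "(nat \<Rightarrow> real) \<Rightarrow> nat set" where
  "fsupp v = {i. v i \<noteq> 0}"

definition ternary :: "(nat \<Rightarrow> real) set" where
  "ternary = {v. \<forall>i. v i \<in> {-1, 0, 1}}"

definition sum_zero :: "nat set \<Rightarrow> (nat \<Rightarrow> real) set" where
  "sum_zero S = {v. fsupp v \<subseteq> S \<and> sum v S = 0}"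

text \<open>For \<open>c = central_weight h\<close> and \<open>L\<close> inside
  \<open>sum_zero {..<2 * h}\<close> this is the number of pairs of \<open>h\<close>-sets with
  difference in \<open>L\<close>. A general \<open>c\<close> isolates the two properties of the
  weight that merging needs.\<close>

definition ternary_weight :: "(nat \<Rightarrow> real) \<Rightarrow> (nat \<Rightarrow> real) set \<Rightarrow> real" where
  "ternary_weight c L = (\<Sum>v \<in> L \<inter> ternary. c (card (fsupp v)))"

text \<open>The root e_i - e_j of type A, which is zero for \<open>i = j\<close>. Whether these
  vectors lie in a subspace decides which coordinates can be merged.\<close>

definition root_vec :: "nat \<Rightarrow> nat \<Rightarrow> nat \<Rightarrow> real" where
  "root_vec i j = (\<lambda>l. of_bool (l = i) - of_bool (l = j))"

lemma finite_ternary_supp: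
  assumes "finite S"
  shows "finite {v \<in> ternary. fsupp v \<subseteq> S}"
proof -
  have "{v \<in> ternary. fsupp v \<subseteq> S} \<subseteq> (\<lambda>f i. if i \<in> S then f i else 0) ` (S \<rightarrow>\<^sub>E {-1, 0, 1})"
  proof
    fix v assume "v \<in> {v \<in> ternary. fsupp v \<subseteq> S}"
    then show "v \<in> (\<lambda>f i. if i \<in> S then f i else 0) ` (S \<rightarrow>\<^sub>E {-1, 0, 1})"
      by (intro image_eqI[of _ _ "restrict v S"]) (auto simp: ternary_def fsupp_def fun_eq_iff)
  qed
  then show ?thesis
    by (rule finite_subset) (intro finite_imageI finite_PiE assms; simp)
qed

lemma finite_ternary_Int:
  assumes "finite S" "L \<subseteq> sum_zero S"
  shows "finite (L \<inter> ternary)"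
  by (rule finite_subset[OF _ finite_ternary_supp[OF assms(1)]])
     (use assms in \<open>auto simp: sum_zero_def\<close>)

text \<open>The sum equals the sum, over the classes of \<open>r\<close>, of the squared class sums
  of \<open>v\<close>.\<close>

lemma sum_mult_within_classes_nonneg:
  fixes v :: "'a \<Rightarrow> real"
  assumes "finite S"
  shows "0 \<le> (\<Sum>(i, j) \<in> {(i, j) \<in> S \<times> S. r i = r j}. v i * v j)"
proof -
  have "(\<Sum>(i, j) \<in> {(i, j) \<in> S \<times> S. r i = r j}. v i * v j)
      = (\<Sum>(i, j) \<in> S \<times> S. of_bool (r i = r j) * (v i * v j))"
    using assms by (intro sum.mono_neutral_cong_left) (auto split: if_splits)
  also have "\<dots> = (\<Sum>i\<in>S. \<Sum>j\<in>S. of_bool (r i = r j) * (v i * v j))"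
    by (simp add: sum.cartesian_product)
  also have "\<dots> = (\<Sum>i\<in>S. \<Sum>j\<in>S. \<Sum>c\<in>r ` S. of_bool (r i = c) * of_bool (r j = c) * (v i * v j))"
  proof (intro sum.cong refl)
    fix i j assume "i \<in> S" "j \<in> S"
    have "(\<Sum>c\<in>r ` S. of_bool (r i = c) * of_bool (r j = c) * (v i * v j))
        = (\<Sum>c\<in>r ` S. if c = r i then of_bool (r j = r i) * (v i * v j) else 0)"
      by (intro sum.cong) auto
    also have "\<dots> = of_bool (r i = r j) * (v i * v j)"
      using \<open>i \<in> S\<close> assms by (simp add: sum.delta eq_commute)
    finally show "of_bool (r i = r j) * (v i * v j)
      = (\<Sum>c\<in>r ` S. of_bool (r i = c) * of_bool (r j = c) * (v i * v j))" by simp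
  qed
  also have "\<dots> = (\<Sum>i\<in>S. \<Sum>c\<in>r ` S. \<Sum>j\<in>S. of_bool (r i = c) * of_bool (r j = c) * (v i * v j))"
    by (intro sum.cong refl sum.swap)
  also have "\<dots> = (\<Sum>c\<in>r ` S. \<Sum>i\<in>S. \<Sum>j\<in>S. of_bool (r i = c) * of_bool (r j = c) * (v i * v j))"
    by (rule sum.swap)
  also have "\<dots> = (\<Sum>c\<in>r ` S. (\<Sum>i\<in>S. of_bool (r i = c) * v i)\<^sup>2)"
    by (intro sum.cong refl) (simp add: power2_eq_square sum_product mult_ac)
  also have "\<dots> \<ge> 0" by (intro sum_nonneg) auto
  finally show ?thesis .
qed

lemma root_vec_trans:
  assumes "fvs.subspace L" "root_vec i j \<in> L" "root_vec j l \<in> L"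
  shows "root_vec i l \<in> L"
proof -
  have "root_vec i l = root_vec i j + root_vec j l" by (auto simp: root_vec_def)
  then show ?thesis using assms fvs.subspace_add by metis
qed

lemma root_vec_sym:
  assumes "fvs.subspace L" "root_vec i j \<in> L"
  shows "root_vec j i \<in> L"
proof -
  have "root_vec j i = - root_vec i j" by (auto simp: root_vec_def)
  then show ?thesis using assms fvs.subspace_neg by metis
qed

text \<open>Membership of \<open>root_vec i j\<close> in \<open>L\<close> is an equivalence relation
  on indices. The sum over all pairs is the square of the coordinate sum, hence zero, and the part
  within classes is nonnegative.\<close>

lemma sum_mult_cross_nonpos:
  assumes "finite S" "fvs.subspace L" "v \<in> sum_zero S"
  shows "(\<Sum>(i, j) \<in> {(i, j) \<in> S \<times> S. root_vec i j \<notin> L}. v i * v j) \<le> 0"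
proof -
  define r where "r = (\<lambda>i. {j. root_vec i j \<in> L})"
  have refl: "root_vec i i \<in> L" for i
    using fvs.subspace_0[OF assms(2)] by (simp add: root_vec_def zero_fun_def)
  have r: "r i = r j \<longleftrightarrow> root_vec i j \<in> L" for i j
    unfolding r_def using refl root_vec_trans[OF assms(2)] root_vec_sym[OF assms(2)] by blast
  let ?f = "\<lambda>(i, j). v i * v j"
  let ?X = "{(i, j) \<in> S \<times> S. root_vec i j \<notin> L}" and ?Y = "{(i, j) \<in> S \<times> S. r i = r j}"
  have "sum ?f (S \<times> S) = sum v S * sum v S"
    by (simp add: sum.cartesian_product[symmetric] sum_product)
  then have "sum ?f (S \<times> S) = 0" using assms(3) by (simp add: sum_zero_def)
  moreover have "sum ?f (S \<times> S) = sum ?f ?X + sum ?f ?Y"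
  proof -
    have "?X \<subseteq> S \<times> S" "S \<times> S - ?X = ?Y" by (auto simp: r)
    then show ?thesis using assms(1) sum.subset_diff[of ?X "S \<times> S" ?f] by (simp add: add.commute)
  qed
  ultimately show ?thesis using sum_mult_within_classes_nonneg[OF assms(1), where r = r and v = v] by linarith
qed

section \<open>Merging two coordinates\<close>

definition merge :: "nat \<Rightarrow> nat \<Rightarrow> (nat \<Rightarrow> real) \<Rightarrow> nat \<Rightarrow> real" where
  "merge i j v = v(i := v i + v j, j := 0)"

lemma merge_zero: "merge i j 0 = 0"
  and merge_add: "merge i j (u + v) = merge i j u + merge i j v"
  and merge_diff: "merge i j (u - v) = merge i j u - merge i j v"
  and merge_scale: "merge i j (\<lambda>l. c * v l) = (\<lambda>l. c * merge i j v l)"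
  by (auto simp: merge_def fun_eq_iff algebra_simps)

lemma merge_sum: "merge i j (\<Sum>a\<in>A. f a) = (\<Sum>a\<in>A. merge i j (f a))"
  by (induction A rule: infinite_finite_induct) (simp_all only: merge_zero merge_add sum.infinite sum.empty sum.insert not_False_eq_True)

lemma subspace_merge_image:
  assumes "fvs.subspace L"
  shows "fvs.subspace (merge i j ` L)"
  unfolding fvs.subspace_def
proof (intro conjI ballI allI)
  show "0 \<in> merge i j ` L"
    using fvs.subspace_0[OF assms] merge_zero by (metis image_eqI)
  show "x + y \<in> merge i j ` L" if "x \<in> merge i j ` L" "y \<in> merge i j ` L" for x y
  proof -
    from that obtain u v where "u \<in> L" "v \<in> L" "x = merge i j u" "y = merge i j v" by blast
    then have "u + v \<in> L" "x + y = merge i j (u + v)"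
      using fvs.subspace_add[OF assms] by (simp_all only: merge_add)
    then show ?thesis by blast
  qed
  show "(\<lambda>l. c * x l) \<in> merge i j ` L" if "x \<in> merge i j ` L" for c x
  proof -
    from that obtain v where "v \<in> L" "x = merge i j v" by blast
    then have "(\<lambda>l. c * v l) \<in> L" "(\<lambda>l. c * x l) = merge i j (\<lambda>l. c * v l)"
      using fvs.subspace_scale[OF assms] by (simp_all only: merge_scale)
    then show ?thesis by blast
  qed
qed

text \<open>A vector killed by merging vanishes off \<open>i\<close> and \<open>j\<close> and takes
  opposite values there, so it is a multiple of \<open>root_vec i j\<close>. The hypothesis also
  forces \<open>i \<noteq> j\<close>, since zero lies in \<open>L\<close>.\<close>

lemma inj_on_merge:
  assumes "fvs.subspace L" "root_vec i j \<notin> L"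
  shows "inj_on (merge i j) L"
proof (rule inj_onI)
  fix u v assume uv: "u \<in> L" "v \<in> L" "merge i j u = merge i j v"
  define x where "x = u - v"
  have x: "x \<in> L" using uv fvs.subspace_diff[OF assms(1)] by (simp add: x_def)
  have m: "merge i j x = 0" using uv by (simp add: x_def merge_diff)
  have 1: "x l = 0" if "l \<noteq> i" "l \<noteq> j" for l
    using fun_cong[OF m, of l] that by (simp add: merge_def)
  have "i \<noteq> j" using assms fvs.subspace_0[OF assms(1)] by (auto simp: root_vec_def zero_fun_def)
  then have 2: "x i = - x j" using fun_cong[OF m, of i] by (simp add: merge_def)
  have "x i = 0"
  proof (rule ccontr)
    assume "x i \<noteq> 0"
    have "(\<lambda>l. (1 / x i) * x l) \<in> L" using fvs.subspace_scale[OF assms(1) x] .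
    moreover have "(\<lambda>l. (1 / x i) * x l) = root_vec i j"
      using 1 2 \<open>x i \<noteq> 0\<close> \<open>i \<noteq> j\<close> by (auto simp: root_vec_def fun_eq_iff)
    ultimately show False using assms by simp
  qed
  then have "x = 0" using 1 2 by (auto simp: fun_eq_iff) (metis neg_equal_0_iff_equal)
  then show "u = v" by (simp add: x_def)
qed

lemma merge_sum_zero:
  assumes "finite S" "i \<in> S" "j \<in> S" "i \<noteq> j" "v \<in> sum_zero S"
  shows "merge i j v \<in> sum_zero (S - {j})"
proof -
  have "sum (merge i j v) (S - {j}) = (v i + v j) + sum (merge i j v) (S - {j} - {i})"
    using assms by (subst sum.remove[of _ i]) (auto simp: merge_def)
  also have "sum (merge i j v) (S - {j} - {i}) = sum v (S - {j} - {i})"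
    by (intro sum.cong) (auto simp: merge_def)
  also have "(v i + v j) + sum v (S - {j} - {i}) = sum v S"
    using assms by (simp add: sum.remove[of S j] sum.remove[of "S - {j}" i])
  finally show ?thesis
    using assms by (auto simp: sum_zero_def fsupp_def merge_def)
qed

text \<open>The factor \<open>1 - v i * v j\<close> is 0 when merging leaves the ternary vectors, 2 when merging
  shrinks the support by two, and 1 otherwise.\<close>

lemma ternary_weight_merge:
  assumes "finite S" "fvs.subspace L" "L \<subseteq> sum_zero S" "i \<in> S" "j \<in> S" "root_vec i j \<notin> L"
    and c: "\<And>n. c n \<ge> 0" "\<And>n. c n \<ge> 2 * c (n + 2)"
    and neg: "(\<Sum>v \<in> L \<inter> ternary. c (card (fsupp v)) * (v i * v j)) \<le> 0"
  shows "ternary_weight c L \<le> ternary_weight c (merge i j ` L)"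
proof -
  let ?T = "L \<inter> ternary" and ?w = "\<lambda>v. c (card (fsupp v))"
  let ?G = "{v \<in> ?T. merge i j v \<in> ternary}"
  have "i \<noteq> j" using assms fvs.subspace_0[OF assms(2)] by (auto simp: root_vec_def zero_fun_def)
  have fin: "finite ?T" by (rule finite_ternary_Int[OF assms(1,3)])
  have bound: "?w v * (1 - v i * v j) \<le> (if v \<in> ?G then ?w (merge i j v) else 0)" if v: "v \<in> ?T" for v
  proof -
    have fs: "finite (fsupp v)"
      using v assms by (auto simp: sum_zero_def intro: finite_subset)
    have vij: "v i \<in> {-1, 0, 1}" "v j \<in> {-1, 0, 1}" using v by (auto simp: ternary_def)
    have tern: "merge i j v \<in> ternary" if "v i + v j \<in> {-1, 0, 1}"
      using v that by (auto simp: ternary_def merge_def)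
    consider "v i * v j = 1" | "v i * v j = -1" | "v i * v j = 0" using vij by auto
    then show ?thesis
    proof cases
      case 1
      then show ?thesis using c by auto
    next
      case 2
      then have 0: "v i + v j = 0" using vij by auto
      have "fsupp v = insert i (insert j (fsupp (merge i j v)))"
        using 0 2 by (auto simp: fsupp_def merge_def)
      moreover have "i \<notin> fsupp (merge i j v)" "j \<notin> fsupp (merge i j v)"
        using 0 \<open>i \<noteq> j\<close> by (auto simp: fsupp_def merge_def)
      ultimately have "card (fsupp v) = card (fsupp (merge i j v)) + 2"
        using fs \<open>i \<noteq> j\<close> by (metis (no_types, lifting) add_2_eq_Suc' card_insert_disjoint finite_insert insertE)
      then show ?thesis using 0 2 tern v c(2)[of "card (fsupp (merge i j v))"] by simp
    next
      case 3
      have "card (fsupp (merge i j v)) = card (fsupp v)"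
      proof (cases "v j = 0")
        case True
        then have "merge i j v = v" by (auto simp: merge_def)
        then show ?thesis by simp
      next
        case False
        then have "v i = 0" using 3 by auto
        then have "fsupp (merge i j v) = insert i (fsupp v - {j})"
          using False by (auto simp: fsupp_def merge_def \<open>i \<noteq> j\<close>)
        moreover have "i \<notin> fsupp v" "j \<in> fsupp v" using False \<open>v i = 0\<close> by (auto simp: fsupp_def)
        ultimately show ?thesis using fs by (metis Diff_iff card.remove card_insert_disjoint finite_Diff)
      qed
      moreover have "v i + v j \<in> {-1, 0, 1}" using 3 vij by auto
      ultimately show ?thesis using tern v unfolding 3 by simp
    qed
  qed
  \<comment> \<open>Negative correlation enters here: subtracting a nonpositive sum turns each
    weight into the weight times \<open>1 - v i * v j\<close>, which \<open>bound\<close> controls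
    term by term.\<close>
  have "ternary_weight c L \<le> ternary_weight c L - (\<Sum>v \<in> ?T. ?w v * (v i * v j))"
    using neg by simp
  also have "\<dots> = (\<Sum>v \<in> ?T. ?w v * (1 - v i * v j))"
    by (simp add: ternary_weight_def sum_subtractf[symmetric] algebra_simps)
  also have "\<dots> \<le> (\<Sum>v \<in> ?T. if v \<in> ?G then ?w (merge i j v) else 0)"
    by (intro sum_mono bound)
  also have "\<dots> = (\<Sum>v \<in> ?G. ?w (merge i j v))"
    using fin by (intro sum.mono_neutral_cong_right) auto
  also have "\<dots> = (\<Sum>v \<in> merge i j ` ?G. ?w v)"
    using inj_on_merge[OF assms(2,6)] by (subst sum.reindex) (auto intro: inj_on_subset)
  also have "\<dots> \<le> ternary_weight c (merge i j ` L)"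
    unfolding ternary_weight_def
  proof (rule sum_mono2)
    have "merge i j ` L \<subseteq> sum_zero (S - {j})"
      using merge_sum_zero[OF assms(1,4,5) \<open>i \<noteq> j\<close>] assms(3) by auto
    then show "finite (merge i j ` L \<inter> ternary)"
      using finite_ternary_Int[of "S - {j}"] assms(1) by blast
  qed (use c in auto)
  finally show ?thesis .
qed

text \<open>Merging is linear, so a relation among chosen preimages would map to a relation in
  \<open>A\<close>. Lower bounds on the rank of a merged space thus pass to the original
  one.\<close>

lemma independent_merge_lift:
  assumes "A \<subseteq> merge i j ` L" "fvs.independent A" "finite A"
  shows "\<exists>B \<subseteq> L. fvs.independent B \<and> finite B \<and> card B = card A"
proof -
  obtain B where B: "B \<subseteq> L" "inj_on (merge i j) B" "A = merge i j ` B"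
    using assms(1) by (meson subset_image_inj)
  have finB: "finite B" using B assms(3) finite_imageD by blast
  have "fvs.independent B"
  proof (rule ccontr)
    assume "\<not> fvs.independent B"
    then obtain u where u: "\<exists>v\<in>B. u v \<noteq> 0" "(\<Sum>v\<in>B. (\<lambda>l. u v * v l)) = 0"
      using fvs.dependent_finite[OF finB] by auto
    let ?u = "\<lambda>a. u (inv_into B (merge i j) a)"
    have "(\<Sum>a\<in>A. (\<lambda>l. ?u a * a l)) = (\<Sum>v\<in>B. (\<lambda>l. u v * merge i j v l))"
      using B(2) by (simp add: B(3) sum.reindex)
    also have "\<dots> = merge i j (\<Sum>v\<in>B. (\<lambda>l. u v * v l))"
      by (simp add: merge_sum merge_scale)
    also have "\<dots> = 0" by (simp add: u merge_zero)
    finally have "(\<Sum>a\<in>A. (\<lambda>l. ?u a * a l)) = 0" .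
    moreover have "\<exists>a\<in>A. ?u a \<noteq> 0" using u(1) B(2) by (auto simp: B(3))
    ultimately show False using assms(2) fvs.dependent_finite[OF assms(3)] by auto
  qed
  then show ?thesis using B finB by (intro exI[of _ B]) (auto simp: card_image)
qed

text \<open>Evaluate a linear relation at a coordinate \<open>i\<close> of \<open>S\<close>: only
  \<open>root_vec i j\<close> is nonzero there, because \<open>j\<close> lies outside
  \<open>S\<close>.\<close>

lemma independent_root_vecs:
  assumes "finite S" "j \<notin> S"
  shows "fvs.independent ((\<lambda>i. root_vec i j) ` S)" "card ((\<lambda>i. root_vec i j) ` S) = card S"
proof -
  have inj: "inj_on (\<lambda>i. root_vec i j) S"
  proof (rule inj_onI)
    fix i i' assume "i \<in> S" "i' \<in> S" "root_vec i j = root_vec i' j"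
    then have "root_vec i j i = root_vec i' j i" by simp
    then show "i = i'" using \<open>i \<in> S\<close> assms
      by (auto simp: root_vec_def split: if_splits)
  qed
  then show "card ((\<lambda>i. root_vec i j) ` S) = card S" by (rule card_image)
  show "fvs.independent ((\<lambda>i. root_vec i j) ` S)"
  proof (rule ccontr)
    assume "\<not> ?thesis"
    then obtain u where u: "\<exists>i\<in>S. u (root_vec i j) \<noteq> 0"
        "(\<Sum>v\<in>(\<lambda>i. root_vec i j) ` S. (\<lambda>l. u v * v l)) = 0"
      using fvs.dependent_finite[of "(\<lambda>i. root_vec i j) ` S"] assms(1) by auto
    then have 0: "(\<Sum>i\<in>S. (\<lambda>l. u (root_vec i j) * root_vec i j l)) = 0"
      using inj by (simp add: sum.reindex)
    have "u (root_vec i j) = 0" if "i \<in> S" for i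
    proof -
      have "0 = (\<Sum>i'\<in>S. u (root_vec i' j) * root_vec i' j i)"
        using fun_cong[OF 0, of i] by (simp add: sum_fun_apply)
      also have "\<dots> = (\<Sum>i'\<in>S. if i' = i then u (root_vec i j) else 0)"
        using that assms by (intro sum.cong) (auto simp: root_vec_def)
      finally show ?thesis using that assms(1) by simp
    qed
    with u(1) show False by auto
  qed
qed

text \<open>Induction on the number of coordinates. While some \<open>root_vec i j\<close> is
  missing from \<open>L\<close>, a merge removes one coordinate without lowering the weight; once
  all are present, \<open>J = S\<close> works. The set \<open>A\<close> certifies that
  \<open>L\<close> has rank at least \<open>card J - 1\<close>.\<close>

lemma ternary_weight_le_sum_zero:
  fixes c :: "nat \<Rightarrow> real"
  assumes "finite S" "fvs.subspace L" "L \<subseteq> sum_zero S"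
    and c: "\<And>n. c n \<ge> 0" "\<And>n. c n \<ge> 2 * c (n + 2)"
  shows "\<exists>J A. J \<subseteq> S \<and> ternary_weight c L \<le> ternary_weight c (sum_zero J) \<and>
           A \<subseteq> L \<and> fvs.independent A \<and> finite A \<and> card J \<le> card A + 1"
  using assms(1-3)
proof (induction "card S" arbitrary: S L rule: less_induct)
  case less
  let ?X = "{(i, j) \<in> S \<times> S. root_vec i j \<notin> L}"
  show ?case
  proof (cases "?X = {}")
    case True
    have "ternary_weight c L \<le> ternary_weight c (sum_zero S)"
      unfolding ternary_weight_def using less.prems c
      by (intro sum_mono2 finite_ternary_Int) auto
    moreover have "\<exists>A \<subseteq> L. fvs.independent A \<and> finite A \<and> card S \<le> card A + 1"
    proof (cases "S = {}")
      case True
      then show ?thesis by (intro exI[of _ "{}"]) (simp add: fvs.independent_empty)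
    next
      case False
      then obtain j where j: "j \<in> S" by auto
      let ?A = "(\<lambda>i. root_vec i j) ` (S - {j})"
      have "?A \<subseteq> L" using True j by auto
      then show ?thesis using independent_root_vecs[of "S - {j}" j] less.prems j
        by (intro exI[of _ ?A]) auto
    qed
    ultimately show ?thesis by blast
  next
    case False
    let ?w = "\<lambda>v. c (card (fsupp v))"
    have "finite ?X" using less.prems by (auto intro: finite_subset[of _ "S \<times> S"])
    have "(\<Sum>(i, j)\<in>?X. \<Sum>v \<in> L \<inter> ternary. ?w v * (v i * v j))
        = (\<Sum>v \<in> L \<inter> ternary. ?w v * (\<Sum>(i, j)\<in>?X. v i * v j))"
      by (simp add: sum_distrib_left case_prod_unfold sum.swap[of _ "L \<inter> ternary"])
    also have "\<dots> \<le> 0"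
    proof (rule sum_nonpos)
      fix v assume "v \<in> L \<inter> ternary"
      then have "v \<in> sum_zero S" using less.prems(3) by auto
      from sum_mult_cross_nonpos[OF less.prems(1,2) this] show "?w v * (\<Sum>(i, j)\<in>?X. v i * v j) \<le> 0"
        by (rule mult_nonneg_nonpos[OF c(1)])
    qed
    \<comment> \<open>Averaging: the correlations sum to at most zero over the nonempty finite set
      of cross pairs, so one of them is at most zero.\<close>
    finally have "\<exists>(i, j)\<in>?X. (\<Sum>v \<in> L \<inter> ternary. ?w v * (v i * v j)) \<le> 0"
      using False \<open>finite ?X\<close> sum_pos[of ?X "\<lambda>(i, j). \<Sum>v \<in> L \<inter> ternary. ?w v * (v i * v j)"]
      by (force simp: not_le)
    then obtain i j where ij: "i \<in> S" "j \<in> S" "root_vec i j \<notin> L"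
      "(\<Sum>v \<in> L \<inter> ternary. ?w v * (v i * v j)) \<le> 0" by auto
    have "i \<noteq> j" using ij fvs.subspace_0[OF less.prems(2)] by (auto simp: root_vec_def zero_fun_def)
    have le: "ternary_weight c L \<le> ternary_weight c (merge i j ` L)"
      using ternary_weight_merge[OF less.prems ij(1-3) c ij(4)] .
    have "card (S - {j}) < card S" using ij less.prems by (meson card_Diff1_less)
    moreover have "merge i j ` L \<subseteq> sum_zero (S - {j})"
      using merge_sum_zero[OF less.prems(1) ij(1,2) \<open>i \<noteq> j\<close>] less.prems(3) by auto
    ultimately obtain J A where "J \<subseteq> S - {j}"
        "ternary_weight c (merge i j ` L) \<le> ternary_weight c (sum_zero J)"
        "A \<subseteq> merge i j ` L" "fvs.independent A" "finite A" "card J \<le> card A + 1"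
      using less.hyps[of "S - {j}" "merge i j ` L"] subspace_merge_image[OF less.prems(2)] less.prems(1)
      by auto
    then show ?thesis using le independent_merge_lift[of A i j L]
      by (metis Diff_subset order_trans)
  qed
qed

subsection \<open>Pairs of sets that agree off a given set\<close>

text \<open>The two sizes are separate parameters because the halves of a balanced pair in
  \<open>agree_count_add\<close> may have different sizes.\<close>

definition agree_pairs :: "'a set \<Rightarrow> 'a set \<Rightarrow> nat \<Rightarrow> nat \<Rightarrow> ('a set \<times> 'a set) set" where
  "agree_pairs K J s t =
     {(a, b). a \<subseteq> K \<and> b \<subseteq> K \<and> card a = s \<and> card b = t \<and> a - J = b - J}"

definition agree_count :: "nat \<Rightarrow> nat \<Rightarrow> nat \<Rightarrow> nat" where
  "agree_count k h q = (\<Sum>x\<le>h. (q choose x)\<^sup>2 * ((k - q) choose (h - x)))"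

lemma finite_agree_pairs: "finite K \<Longrightarrow> finite (agree_pairs K J s t)"
  by (rule finite_subset[of _ "Pow K \<times> Pow K"]) (auto simp: agree_pairs_def)

text \<open>A pair is determined by its two traces on \<open>J\<close> and its common part outside.
  The traces have the same size, the \<open>x\<close> of \<open>agree_count\<close>, because the
  whole sets do.\<close>

lemma card_agree_pairs:
  assumes K: "finite K" and J: "J \<subseteq> K"
  shows "card (agree_pairs K J h h) = agree_count (card K) h (card J)"
proof -
  let ?S = "\<lambda>X n. {a. a \<subseteq> X \<and> card a = n}"
  have finJ: "finite J" using K J finite_subset by blast
  let ?D = "SIGMA x:{..h}. ?S J x \<times> ?S J x \<times> ?S (K - J) (h - x)"
  have "bij_betw (\<lambda>(x, a, b, c). (a \<union> c, b \<union> c)) ?D (agree_pairs K J h h)"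
  proof (rule bij_betw_byWitness[where f' = "\<lambda>(a, b). (card (a \<inter> J), a \<inter> J, b \<inter> J, a - J)"])
    show "\<forall>p\<in>?D. (\<lambda>(a, b). (card (a \<inter> J), a \<inter> J, b \<inter> J, a - J))
            ((\<lambda>(x, a, b, c). (a \<union> c, b \<union> c)) p) = p"
    proof
      fix p assume "p \<in> ?D"
      then obtain x a b c where p: "p = (x, a, b, c)" "a \<subseteq> J" "card a = x" "b \<subseteq> J" "c \<subseteq> K - J"
        by auto
      then have "(a \<union> c) \<inter> J = a" "(b \<union> c) \<inter> J = b" "a \<union> c - J = c" by auto
      then show "(\<lambda>(a, b). (card (a \<inter> J), a \<inter> J, b \<inter> J, a - J))
            ((\<lambda>(x, a, b, c). (a \<union> c, b \<union> c)) p) = p" using p by simp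
    qed
    show "\<forall>q\<in>agree_pairs K J h h. (\<lambda>(x, a, b, c). (a \<union> c, b \<union> c))
            ((\<lambda>(a, b). (card (a \<inter> J), a \<inter> J, b \<inter> J, a - J)) q) = q"
      by (auto simp: agree_pairs_def)
    show "(\<lambda>(x, a, b, c). (a \<union> c, b \<union> c)) ` ?D \<subseteq> agree_pairs K J h h"
    proof
      fix q assume "q \<in> (\<lambda>(x, a, b, c). (a \<union> c, b \<union> c)) ` ?D"
      then obtain x a b c where q: "q = (a \<union> c, b \<union> c)" "x \<le> h" "a \<subseteq> J" "card a = x"
        "b \<subseteq> J" "card b = x" "c \<subseteq> K - J" "card c = h - x" by auto
      have fin: "finite a" "finite b" "finite c" using q K finJ by (auto intro: finite_subset)
      have "card (a \<union> c) = x + (h - x)" "card (b \<union> c) = x + (h - x)"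
      proof -
        have "a \<inter> c = {}" "b \<inter> c = {}" using q by auto
        then show "card (a \<union> c) = x + (h - x)" "card (b \<union> c) = x + (h - x)"
          using q fin by (simp_all add: card_Un_disjoint)
      qed
      then show "q \<in> agree_pairs K J h h" using q J by (auto simp: agree_pairs_def)
    qed
    show "(\<lambda>(a, b). (card (a \<inter> J), a \<inter> J, b \<inter> J, a - J)) ` agree_pairs K J h h \<subseteq> ?D"
    proof
      fix p assume "p \<in> (\<lambda>(a, b). (card (a \<inter> J), a \<inter> J, b \<inter> J, a - J)) ` agree_pairs K J h h"
      then obtain a b where p: "p = (card (a \<inter> J), a \<inter> J, b \<inter> J, a - J)" and
        ab: "a \<subseteq> K" "b \<subseteq> K" "card a = h" "card b = h" "a - J = b - J"
        by (auto simp: agree_pairs_def)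
      have fin: "finite a" "finite b" using ab K by (auto intro: finite_subset)
      have "card a = card (a \<inter> J) + card (a - J)" "card b = card (b \<inter> J) + card (b - J)"
        using fin by (metis card_Diff_subset_Int Int_lower1 card_mono le_add_diff_inverse finite_Int)+
      then show "p \<in> ?D" using p ab by auto
    qed
  qed
  then have "card (agree_pairs K J h h) = card ?D" by (rule bij_betw_same_card[symmetric])
  also have "\<dots> = (\<Sum>x\<le>h. card (?S J x \<times> ?S J x \<times> ?S (K - J) (h - x)))"
    using K finJ by (intro card_SigmaI) auto
  also have "\<dots> = agree_count (card K) h (card J)"
    unfolding agree_count_def using K J finJ
    by (intro sum.cong) (auto simp: card_cartesian_product n_subsets card_Diff_subset power2_eq_square)
  finally show ?thesis .
qed

text \<open>Split the ground set into two halves and complement the second one: the count becomes an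
  inner product of a vector depending on \<open>i\<close> with one depending on \<open>j\<close>.\<close>

lemma agree_count_add:
  assumes "i \<le> h" "j \<le> h"
  shows "agree_count (2 * h) h (i + j) =
    (\<Sum>p \<in> {..h} \<times> {..h}. card (agree_pairs {..<h} {..<i} (fst p) (snd p)) *
                          card (agree_pairs {..<h} {..<j} (fst p) (snd p)))"
proof -
  let ?A = "{..<h}"
  let ?K = "?A <+> ?A" and ?J = "{..<i} <+> {..<j}"
  let ?D = "SIGMA p:{..h} \<times> {..h}. agree_pairs ?A {..<i} (fst p) (snd p) \<times>
                                  agree_pairs ?A {..<j} (fst p) (snd p)"
  \<comment> \<open>Complementing in the second half turns the size condition
    \<open>card a + (h - card c) = h\<close> into \<open>card a = card c\<close>, so the two halves
    are linked only through the pair \<open>p\<close> of sizes.\<close>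
  let ?f = "\<lambda>(p, (a, b), (c, d)). (a <+> (?A - c), b <+> (?A - d))"
  let ?g = "\<lambda>(a, b). ((card (Inl -` a), card (Inl -` b)), (Inl -` a, Inl -` b),
                      (?A - Inr -` a, ?A - Inr -` b))"
  have vim: "Inl -` (x <+> y) = x" "Inr -` (x <+> y) = y" "(Inl -` z) <+> (Inr -` z) = z"
    for x y :: "nat set" and z :: "(nat + nat) set"
    by (auto, metis (no_types, lifting) InlI InrI sum.exhaust vimageI)
  have le: "card x \<le> h" if "x \<subseteq> ?A" for x using card_mono[OF _ that] by simp
  have "bij_betw ?f ?D (agree_pairs ?K ?J h h)"
  proof (rule bij_betw_byWitness[where f' = ?g])
    show "\<forall>p\<in>?D. ?g (?f p) = p"
    proof
      fix x assume "x \<in> ?D"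
      then obtain s t a b c d where x: "x = ((s, t), (a, b), (c, d))"
        "(a, b) \<in> agree_pairs ?A {..<i} s t" "(c, d) \<in> agree_pairs ?A {..<j} s t"
        by (auto simp: agree_pairs_def)
      then have "a \<subseteq> ?A" "b \<subseteq> ?A" "card a = s" "card b = t" "?A - (?A - c) = c" "?A - (?A - d) = d"
        by (auto simp: agree_pairs_def)
      then show "?g (?f x) = x" using x(1) by (simp add: vim)
    qed
    show "\<forall>q\<in>agree_pairs ?K ?J h h. ?f (?g q) = q"
    proof
      fix q assume "q \<in> agree_pairs ?K ?J h h"
      then obtain a b where q: "q = (a, b)" "a \<subseteq> ?K" "b \<subseteq> ?K" by (auto simp: agree_pairs_def)
      then have "?A - (?A - Inr -` a) = Inr -` a" "?A - (?A - Inr -` b) = Inr -` b" by auto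
      then show "?f (?g q) = q" using q(1) by (simp add: vim)
    qed
    show "?f ` ?D \<subseteq> agree_pairs ?K ?J h h"
    proof
      fix q assume "q \<in> ?f ` ?D"
      then obtain s t a b c d where q: "q = (a <+> (?A - c), b <+> (?A - d))"
        "a \<subseteq> ?A" "b \<subseteq> ?A" "c \<subseteq> ?A" "d \<subseteq> ?A" "card a = s" "card c = s" "card b = t" "card d = t"
        "a - {..<i} = b - {..<i}" "c - {..<j} = d - {..<j}"
        by (auto simp: agree_pairs_def)
      have fin: "finite a" "finite b" "finite c" "finite d" using q by (auto intro: finite_subset)
      have "card (a <+> (?A - c)) = h" "card (b <+> (?A - d)) = h"
        using q fin le[OF q(4)] le[OF q(5)] by (auto simp: card_Plus card_Diff_subset)
      moreover have "(a <+> (?A - c)) - ?J = (a - {..<i}) <+> (?A - {..<j} - (c - {..<j}))"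
        "(b <+> (?A - d)) - ?J = (b - {..<i}) <+> (?A - {..<j} - (d - {..<j}))" by auto
      ultimately show "q \<in> agree_pairs ?K ?J h h" using q by (auto simp: agree_pairs_def)
    qed
    show "?g ` agree_pairs ?K ?J h h \<subseteq> ?D"
    proof
      fix p assume "p \<in> ?g ` agree_pairs ?K ?J h h"
      then obtain a b where p: "p = ?g (a, b)" and ab: "a \<subseteq> ?K" "b \<subseteq> ?K" "card a = h" "card b = h"
        "a - ?J = b - ?J" by (auto simp: agree_pairs_def)
      have fin: "finite (Inl -` a)" "finite (Inr -` a)" "finite (Inl -` b)" "finite (Inr -` b)"
        using ab by (auto intro!: finite_subset[of _ ?A])
      have sub: "Inl -` a \<subseteq> ?A" "Inr -` a \<subseteq> ?A" "Inl -` b \<subseteq> ?A" "Inr -` b \<subseteq> ?A" using ab by auto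
      have "card (Inl -` a) + card (Inr -` a) = h" "card (Inl -` b) + card (Inr -` b) = h"
        using ab fin vim(3)[of a] vim(3)[of b] by (metis card_Plus)+
      then have "card (?A - Inr -` a) = card (Inl -` a)" "card (?A - Inr -` b) = card (Inl -` b)"
        using fin sub by (auto simp: card_Diff_subset)
      moreover have "Inl -` a - {..<i} = Inl -` b - {..<i}"
        "?A - Inr -` a - {..<j} = ?A - Inr -` b - {..<j}"
        using ab(5) by (auto simp: set_eq_iff)
      ultimately show "p \<in> ?D"
        using p sub le[OF sub(1)] le[OF sub(3)] by (simp add: agree_pairs_def)
    qed
  qed
  then have "card (agree_pairs ?K ?J h h) = card ?D" by (rule bij_betw_same_card[symmetric])
  also have "\<dots> = (\<Sum>p \<in> {..h} \<times> {..h}. card (agree_pairs {..<h} {..<i} (fst p) (snd p)) *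
                          card (agree_pairs {..<h} {..<j} (fst p) (snd p)))"
    by (subst card_SigmaI) (auto simp: card_cartesian_product finite_agree_pairs)
  also have "card (agree_pairs ?K ?J h h) = agree_count (2 * h) h (i + j)"
    using assms by (subst card_agree_pairs) (auto simp: card_Plus mult_2)
  finally show ?thesis .
qed

text \<open>Cauchy--Schwarz for the two vectors, indexed by pairs of sizes, in
  \<open>agree_count_add\<close>; the counts at \<open>2 * i\<close> and \<open>2 * j\<close> are
  their squared norms.\<close>

lemma agree_count_log_convex:
  assumes "i \<le> h" "j \<le> h"
  shows "(real (agree_count (2 * h) h (i + j)))\<^sup>2 \<le>
    real (agree_count (2 * h) h (2 * i)) * real (agree_count (2 * h) h (2 * j))"
proof -
  let ?P = "\<lambda>i p. real (card (agree_pairs {..<h} {..<i} (fst p) (snd p)))"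
  have eq: "real (agree_count (2 * h) h (i + j)) = (\<Sum>p \<in> {..h} \<times> {..h}. ?P i p * ?P j p)"
    if "i \<le> h" "j \<le> h" for i j
    unfolding agree_count_add[OF that] by simp
  show ?thesis
    using Cauchy_Schwarz_ineq_sum[of "?P i" "?P j" "{..h} \<times> {..h}"]
      eq[OF assms] eq[OF assms(1) assms(1)] eq[OF assms(2) assms(2)]
    by (simp add: power2_eq_square mult_2[of i] mult_2[of j])
qed

text \<open>The leftmost maximum, if above 1, would be interior with a strictly smaller left
  neighbour, so the product of its neighbours would fall below its square. Avoiding logarithms
  admits zero values of \<open>g\<close>.\<close>

lemma log_convex_max_principle:
  fixes g :: "nat \<Rightarrow> real"
  assumes "\<And>p. g p \<ge> 0" and conv: "\<And>p. a < p \<Longrightarrow> p < b \<Longrightarrow> (g p)\<^sup>2 \<le> g (p - 1) * g (p + 1)"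
    and ends: "g a \<le> 1" "g b \<le> 1" and p: "a \<le> p" "p \<le> b"
  shows "g p \<le> 1"
proof (rule ccontr)
  assume gp: "\<not> g p \<le> 1"
  define M where "M = Max (g ` {a..b})"
  have M: "g x \<le> M" if "a \<le> x" "x \<le> b" for x
    unfolding M_def using that by (intro Max_ge) auto
  have "M \<in> g ` {a..b}" unfolding M_def using p by (intro Max_in) auto
  then have ex: "\<exists>x. a \<le> x \<and> x \<le> b \<and> g x = M" by auto
  define x where "x = (LEAST x. a \<le> x \<and> x \<le> b \<and> g x = M)"
  have x: "a \<le> x" "x \<le> b" "g x = M" using LeastI_ex[OF ex] by (simp_all add: x_def)
  have M1: "M > 1" using M[OF p] gp by linarith
  then have "x \<noteq> a" "x \<noteq> b" using x ends by auto
  then have lt: "a < x" "x < b" using x by auto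
  have "g (x - 1) \<noteq> M"
    using not_less_Least[of "x - 1" "\<lambda>x. a \<le> x \<and> x \<le> b \<and> g x = M"] lt
    by (auto simp: x_def[symmetric])
  then have "g (x - 1) < M" using M[of "x - 1"] lt by fastforce
  moreover have "g (x + 1) \<le> M" using M lt by simp
  ultimately have "g (x - 1) * g (x + 1) < M * M"
    using assms(1) M1 by (meson less_le_trans mult_left_mono mult_strict_right_mono not_less order_less_imp_le zero_less_one order.strict_trans order_le_less_trans)
  then show False using conv[OF lt] x(3) by (simp add: power2_eq_square)
qed

section \<open>Estimates from central binomial coefficients\<close>

lemma central_binomial_Suc:
  "(Suc h) * ((2 * Suc h) choose (Suc h)) = 2 * (2 * h + 1) * ((2 * h) choose h)"
proof -
  have 1: "Suc h * (Suc (2 * h + 1) choose Suc h) = Suc (2 * h + 1) * ((2 * h + 1) choose h)"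
    by (rule Suc_times_binomial_eq[symmetric, of "2 * h + 1" h, unfolded mult.commute[of _ "Suc h"]])
  have "Suc h * (Suc (2 * h) choose Suc h) = Suc (2 * h) * ((2 * h) choose h)"
    using Suc_times_binomial_eq[of "2 * h" h] by (simp add: mult.commute)
  moreover have "(2 * h + 1) choose h = Suc (2 * h) choose Suc h"
    using binomial_symmetric[of h "2 * h + 1"] by simp
  ultimately have "Suc h * ((2 * h + 1) choose h) = (2 * h + 1) * ((2 * h) choose h)" by simp
  moreover have "Suc h * (Suc (2 * h + 1) choose Suc h) = 2 * (Suc h * ((2 * h + 1) choose h))"
    unfolding 1 by simp
  ultimately show ?thesis by simp
qed

text \<open>For \<open>q \<le> 2\<close> only terms with \<open>x \<le> 2\<close> survive, and for
  \<open>q \<ge> 2 * h - 2\<close> only those with \<open>x \<ge> h - 2\<close>. Pascal's rule and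
  symmetry express them through \<open>c\<close> and \<open>e\<close>.\<close>

lemma agree_count_values:
  assumes "h \<ge> 2"
  defines "N \<equiv> (2 * h) choose h" and "c \<equiv> (2 * h - 2) choose (h - 1)" and "e \<equiv> (2 * h - 2) choose h"
  shows "agree_count (2 * h) h 0 = N" "agree_count (2 * h) h 1 = N"
    "agree_count (2 * h) h 2 = N + 2 * c"
    "agree_count (2 * h) h (2 * h - 2) = 2 * c\<^sup>2 + 2 * e\<^sup>2"
    "2 * agree_count (2 * h) h (2 * h - 1) = N\<^sup>2"
    "h * N = 2 * (2 * h - 1) * c" "h * e = (h - 1) * c"
proof -
  obtain g where h: "h = Suc (Suc g)" using assms by (metis One_nat_def add_2_eq_Suc le_Suc_ex)
  have sym: "(2 * h - 2) choose (h - 2) = e"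
    unfolding e_def using binomial_symmetric[of h "2 * h - 2"] h by simp
  have N: "N = 2 * c + 2 * e"
  proof -
    have "N = (Suc (Suc (2 * h - 2))) choose (Suc (Suc g))" unfolding N_def using h by simp
    also have "\<dots> = (2 * h - 2 choose g) + 2 * (2 * h - 2 choose Suc g) + (2 * h - 2 choose (Suc (Suc g)))"
      by simp
    finally show ?thesis using sym h by (simp add: c_def e_def)
  qed
  have S: "(\<Sum>x\<le>h. F x) = F (h - 2) + F (h - 1) + F h" if "\<And>x. x \<le> h \<Longrightarrow> x < h - 2 \<Longrightarrow> F x = 0"
    for F :: "nat \<Rightarrow> nat"
  proof -
    have "(\<Sum>x\<le>h. F x) = (\<Sum>x\<in>{h - 2, h - 1, h}. F x)"
    proof (intro sum.mono_neutral_right ballI)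
      fix i assume "i \<in> {..h} - {h - 2, h - 1, h}"
      then have "i \<le> h" "i < h - 2" by auto
      then show "F i = 0" by (rule that)
    qed auto
    then show ?thesis using h by simp
  qed
  have S0: "(\<Sum>x\<le>h. F x) = F 0 + F 1 + F 2" if "\<And>x. x \<le> h \<Longrightarrow> x > 2 \<Longrightarrow> F x = 0"
    for F :: "nat \<Rightarrow> nat"
  proof -
    have "(\<Sum>x\<le>h. F x) = (\<Sum>x\<in>{0, 1, 2}. F x)"
    proof (intro sum.mono_neutral_right ballI)
      fix i assume "i \<in> {..h} - {0, 1, 2}"
      then show "F i = 0" using that[of i] by auto
    qed (use h in auto)
    then show ?thesis by (simp add: numeral_2_eq_2)
  qed
  show "agree_count (2 * h) h 0 = N"
    unfolding agree_count_def by (subst S0) (auto simp: N_def binomial_eq_0)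
  have ce: "(2 * h - 1) choose h = c + e" "(2 * h - 1) choose (h - 1) = c + e"
    using h sym by (simp_all add: c_def e_def)
  have "agree_count (2 * h) h 1 = (2 * h - 1 choose h) + (2 * h - 1 choose (h - 1))"
    unfolding agree_count_def by (subst S0) (auto simp: binomial_eq_0)
  then show "agree_count (2 * h) h 1 = N" using ce N by simp
  have "agree_count (2 * h) h 2 = e + 4 * c + (2 * h - 2 choose (h - 2))"
    unfolding agree_count_def by (subst S0) (auto simp: binomial_eq_0 c_def e_def)
  then show "agree_count (2 * h) h 2 = N + 2 * c" using sym N by simp
  have "agree_count (2 * h) h (2 * h - 2) = (2 * h - 2 choose (h - 2))\<^sup>2 + 2 * c\<^sup>2 + e\<^sup>2"
    unfolding agree_count_def using h by (subst S) (auto simp: binomial_eq_0 c_def e_def)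
  then show "agree_count (2 * h) h (2 * h - 2) = 2 * c\<^sup>2 + 2 * e\<^sup>2" using sym by simp
  have "agree_count (2 * h) h (2 * h - 1) = (2 * h - 1 choose (h - 1))\<^sup>2 + (2 * h - 1 choose h)\<^sup>2"
    unfolding agree_count_def using h by (subst S) (auto simp: binomial_eq_0)
  then show "2 * agree_count (2 * h) h (2 * h - 1) = N\<^sup>2"
    using ce N by (simp add: power2_eq_square algebra_simps)
  show 1: "h * N = 2 * (2 * h - 1) * c"
    using central_binomial_Suc[of "h - 1"] h by (simp add: N_def c_def)
  have "2 * (h * e) = 2 * ((h - 1) * c)"
    using 1 h unfolding N by (simp add: algebra_simps)
  then show "h * e = (h - 1) * c" by simp
qed

text \<open>Induction from \<open>h = 3\<close>, where the ratio of consecutive terms lies between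
  64/25 and 4. The constants serve \<open>agree_count_endpoints\<close>: 8/5 is what
  \<open>q = 2\<close> demands, and 4/5 is the loss in Bernoulli's inequality for
  \<open>q = 2 * h - 2\<close>.\<close>

lemma central_binomial_bounds:
  assumes "h \<ge> 3"
  shows "(8/5) ^ (2 * h - 2) \<le> real ((2 * h) choose h) / 2"
    "real ((2 * h) choose h) / 2 \<le> 4/5 * 4 ^ (h - 1)"
proof -
  have *: "(64/25) ^ (h - 1) \<le> real ((2 * h) choose h) / 2 \<and>
        real ((2 * h) choose h) / 2 \<le> 4/5 * 4 ^ (h - 1)"
    using assms
  proof (induction h rule: dec_induct)
    case base
    have "(6::nat) choose 3 = 20" by (simp add: numeral_eq_Suc)
    then show ?case by (simp add: power2_eq_square)
  next
    case (step h)
    let ?N = "real ((2 * h) choose h)" and ?N' = "real ((2 * Suc h) choose (Suc h))"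
    have "real (Suc h * ((2 * Suc h) choose (Suc h))) = real (2 * (2 * h + 1) * ((2 * h) choose h))"
      by (simp only: central_binomial_Suc)
    then have eq: "?N' = (2 * (2 * real h + 1) / (real h + 1)) * ?N" by (simp add: field_simps)
    have "2 * (2 * real h + 1) / (real h + 1) \<ge> 64/25" "2 * (2 * real h + 1) / (real h + 1) \<le> 4"
      using step by (simp_all add: field_simps)
    then have "64/25 * ?N \<le> ?N'" "?N' \<le> 4 * ?N"
      unfolding eq by (intro mult_right_mono; simp)+
    moreover have "(64/25 :: real) ^ (Suc h - 1) = 64/25 * (64/25) ^ (h - 1)"
      "(4 :: real) ^ (Suc h - 1) = 4 * 4 ^ (h - 1)"
      using step by (cases h; simp)+
    ultimately show ?case using step by linarith
  qed
  have "(8/5 :: real) ^ (2 * h - 2) = ((8/5)\<^sup>2) ^ (h - 1)"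
    using power_mult[of "8/5::real" 2 "h - 1"] by (simp add: right_diff_distrib')
  also have "\<dots> = (64/25) ^ (h - 1)" by (simp add: power2_eq_square)
  finally show "(8/5) ^ (2 * h - 2) \<le> real ((2 * h) choose h) / 2" using * by simp
  show "real ((2 * h) choose h) / 2 \<le> 4/5 * 4 ^ (h - 1)" using * by simp
qed

text \<open>The base \<open>\<mu>\<close> of the overview, chosen so that
  \<open>agree_count_le\<close> is an equality at \<open>q = 2 * h - 1\<close>.\<close>

definition growth :: "nat \<Rightarrow> real" where
  "growth h = root (2 * h - 2) (real ((2 * h) choose h) / 2)"

lemma growth_power: "h \<ge> 2 \<Longrightarrow> growth h ^ (2 * h - 2) = real ((2 * h) choose h) / 2"
  unfolding growth_def by (intro real_root_pow_pos2) auto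

lemma growth_ge:
  assumes "h \<ge> 3"
  shows "growth h \<ge> 8/5"
proof -
  have "8/5 = root (2 * h - 2) ((8/5) ^ (2 * h - 2))"
    using assms by (intro real_root_pos2[symmetric]) auto
  also have "\<dots> \<le> growth h"
    unfolding growth_def using assms central_binomial_bounds(1)[OF assms]
    by (intro real_root_le_mono) auto
  finally show ?thesis .
qed

text \<open>At \<open>q = 2\<close> the excess \<open>2 * c\<close> is the fraction
  \<open>h / (2 * h - 1) \<le> 3/5\<close> of \<open>N\<close>. At \<open>q = 2 * h - 2\<close> the
  count is \<open>\<rho> * (N\<^sup>2 / 2)\<close> with \<open>\<rho>\<close> slightly above 1/2,
  while \<open>N\<^sup>2 / 2 = N * growth h ^ (2 * h - 2)\<close>, so the claim becomes
  \<open>\<rho> * growth h \<le> 1\<close>.\<close>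

lemma agree_count_endpoints:
  assumes h: "h \<ge> 3"
  defines "N \<equiv> real ((2 * h) choose h)"
  shows "real (agree_count (2 * h) h 2) \<le> N * growth h"
    "real (agree_count (2 * h) h (2 * h - 2)) \<le> N * growth h ^ (2 * h - 3)"
proof -
  define c where "c = real ((2 * h - 2) choose (h - 1))"
  define e where "e = real ((2 * h - 2) choose h)"
  note vals = agree_count_values[of h]
  have h2: "h \<ge> 2" using h by simp
  have Npos: "N > 0" unfolding N_def by (simp add: zero_less_binomial)
  have "real (h * ((2 * h) choose h)) = real (2 * (2 * h - 1) * ((2 * h - 2) choose (h - 1)))"
    using vals(6)[OF h2] by simp
  then have hN: "real h * N = 2 * (2 * real h - 1) * c"
    using h by (simp add: N_def c_def of_nat_diff)
  have "real (h * ((2 * h - 2) choose h)) = real ((h - 1) * ((2 * h - 2) choose (h - 1)))"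
    using vals(7)[OF h2] by simp
  then have he: "real h * e = (real h - 1) * c" using h by (simp add: e_def c_def of_nat_diff)
  have f2: "real (agree_count (2 * h) h 2) = N + 2 * c"
    using vals(3)[OF h2] by (simp add: N_def c_def)
  have fk: "real (agree_count (2 * h) h (2 * h - 2)) = 2 * c\<^sup>2 + 2 * e\<^sup>2"
    using vals(4)[OF h2] by (simp add: c_def e_def)
  have "2 * c \<le> 3/5 * N"
  proof -
    have "(2 * real h - 1) * (2 * c) = real h * N" using hN by simp
    also have "\<dots> \<le> (2 * real h - 1) * (3/5 * N)"
    proof -
      have "real h \<le> (2 * real h - 1) * (3/5)" using h by simp
      then have "real h * N \<le> (2 * real h - 1) * (3/5) * N" using Npos by (intro mult_right_mono) auto
      then show ?thesis by (simp only: mult.assoc)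
    qed
    finally show ?thesis using h by (simp add: mult_le_cancel_left)
  qed
  then have "real (agree_count (2 * h) h 2) \<le> N * (8/5)" unfolding f2 by simp
  also have "\<dots> \<le> N * growth h" using growth_ge[OF h] Npos by (intro mult_left_mono) auto
  finally show "real (agree_count (2 * h) h 2) \<le> N * growth h" .
  define y where "y = 1 / (2 * real h - 1)\<^sup>2"
  define \<rho> where "\<rho> = (1 + y) / 2"
  have sq: "(2 * real h - 1)\<^sup>2 > 0" using h by simp
  have fk': "2 * c\<^sup>2 + 2 * e\<^sup>2 = \<rho> * (N\<^sup>2 / 2)"
  proof -
    have "(real h)\<^sup>2 * (2 * c\<^sup>2 + 2 * e\<^sup>2) = 2 * (real h)\<^sup>2 * c\<^sup>2 + 2 * (real h * e)\<^sup>2"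
      by (simp add: power_mult_distrib algebra_simps)
    also have "\<dots> = 2 * c\<^sup>2 * ((real h)\<^sup>2 + (real h - 1)\<^sup>2)"
      unfolding he power_mult_distrib by (simp only: distrib_left mult.assoc mult.commute mult.left_commute)
    also have "(real h)\<^sup>2 + (real h - 1)\<^sup>2 = \<rho> * (2 * real h - 1)\<^sup>2"
    proof -
      have "y * (2 * real h - 1)\<^sup>2 = 1" using sq by (simp add: y_def)
      then have "\<rho> * (2 * real h - 1)\<^sup>2 = ((2 * real h - 1)\<^sup>2 + 1) / 2"
        unfolding \<rho>_def by (simp add: algebra_simps)
      then show ?thesis by (simp add: power2_eq_square algebra_simps)
    qed
    also have "2 * c\<^sup>2 * (\<rho> * (2 * real h - 1)\<^sup>2) = \<rho> * ((2 * (2 * real h - 1) * c)\<^sup>2 / 2)"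
      by (simp add: power2_eq_square algebra_simps)
    also have "\<dots> = (real h)\<^sup>2 * (\<rho> * (N\<^sup>2 / 2))" unfolding hN[symmetric] by (simp add: power_mult_distrib)
    finally show ?thesis using h by simp
  qed
  have y: "0 \<le> y" unfolding y_def by simp
  have \<rho>0: "\<rho> > 0" unfolding \<rho>_def using y by simp
  \<comment> \<open>This is \<open>\<rho> * growth h \<le> 1\<close> raised to the power
    \<open>2 * h - 2\<close>. Setting \<open>1 + z = 1 / (1 + y)\<close> gives
    \<open>1 / \<rho> = 2 * (1 + z)\<close>, and Bernoulli's inequality keeps
    \<open>(1 + z) ^ (2 * h - 2)\<close> at least 4/5, which matches the upper bound on
    \<open>N / 2\<close>.\<close>
  have "\<rho> ^ (2 * h - 2) * (N / 2) \<le> 1"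
  proof -
    define z where "z = - y / (1 + y)"
    have inv: "1 + z = 1 / (1 + y)" unfolding z_def using y by (simp add: field_simps)
    have z1: "- 1 \<le> z" unfolding z_def using y by (simp add: field_simps)
    have "(2 * real h - 2) * y \<le> 1/5"
    proof -
      have "(2 * real h - 2) * 5 \<le> (2 * real h - 1) * (2 * real h - 1)"
        using h by (intro mult_mono) auto
      then show ?thesis unfolding y_def using sq by (simp add: field_simps power2_eq_square)
    qed
    moreover have "(2 * real h - 2) * z \<ge> - ((2 * real h - 2) * y)"
    proof -
      have "y / (1 + y) \<le> y" using y by (simp add: field_simps)
      then have "(2 * real h - 2) * (y / (1 + y)) \<le> (2 * real h - 2) * y" using h by (intro mult_left_mono) auto
      then show ?thesis unfolding z_def by simp
    qed
    ultimately have "4/5 \<le> 1 + real (2 * h - 2) * z" using h by (simp add: of_nat_diff)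
    also have "\<dots> \<le> (1 + z) ^ (2 * h - 2)" by (rule Bernoulli_inequality[OF z1])
    finally have 1: "4/5 \<le> (1 + z) ^ (2 * h - 2)" .
    have "N / 2 \<le> 4/5 * 4 ^ (h - 1)" using central_binomial_bounds(2)[OF h] by (simp add: N_def)
    also have "\<dots> \<le> (1 + z) ^ (2 * h - 2) * 4 ^ (h - 1)" using 1 by (intro mult_right_mono) auto
    also have "(4::real) ^ (h - 1) = 2 ^ (2 * h - 2)"
      using power_mult[of "2::real" 2 "h - 1"] by (simp add: right_diff_distrib')
    finally have "N / 2 \<le> (1 / \<rho>) ^ (2 * h - 2)"
      unfolding inv by (simp add: power_mult_distrib[symmetric] \<rho>_def)
    then have "\<rho> ^ (2 * h - 2) * (N / 2) \<le> \<rho> ^ (2 * h - 2) * (1 / \<rho>) ^ (2 * h - 2)"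
      using \<rho>0 by (intro mult_left_mono) auto
    also have "\<dots> = 1" using \<rho>0 by (simp add: power_mult_distrib[symmetric])
    finally show ?thesis .
  qed
  then have "(\<rho> * growth h) ^ (2 * h - 2) \<le> 1 ^ (2 * h - 2)"
    by (simp add: power_mult_distrib growth_power[OF h2] N_def)
  then have le1: "\<rho> * growth h \<le> 1"
    using h by (subst (asm) power_mono_iff) (use \<rho>0 growth_ge[OF h] in auto)
  have "N\<^sup>2 / 2 = N * growth h ^ (2 * h - 2)"
    using growth_power[OF h2] by (simp add: N_def power2_eq_square)
  also have "2 * h - 2 = Suc (2 * h - 3)" using h by simp
  finally have "2 * c\<^sup>2 + 2 * e\<^sup>2 = (\<rho> * growth h) * (N * growth h ^ (2 * h - 3))"
    unfolding fk' by simp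
  also have "\<dots> \<le> 1 * (N * growth h ^ (2 * h - 3))"
    using le1 Npos growth_ge[OF h] by (intro mult_right_mono) auto
  finally show "real (agree_count (2 * h) h (2 * h - 2)) \<le> N * growth h ^ (2 * h - 3)"
    unfolding fk by simp
qed

text \<open>Even \<open>q\<close> follow from the maximum principle after division by the log-linear
  right-hand side. Odd \<open>q\<close> strictly between 1 and \<open>2 * h - 1\<close> are squeezed
  between two even values by log-convexity; the two extreme odd values are computed
  directly.\<close>

lemma agree_count_le:
  assumes h: "h \<ge> 3" and q: "1 \<le> q" "q \<le> 2 * h - 1"
  shows "real (agree_count (2 * h) h q) \<le> real ((2 * h) choose h) * growth h ^ (q - 1)"
proof -
  define N where "N = real ((2 * h) choose h)"
  define \<mu> where "\<mu> = growth h"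
  define f where "f q = real (agree_count (2 * h) h q)" for q
  have Npos: "N > 0" unfolding N_def by (simp add: zero_less_binomial)
  have \<mu>: "\<mu> > 1" using growth_ge[OF h] by (simp add: \<mu>_def)
  define g where "g p = f (2 * p) / (N * \<mu> ^ (2 * p - 1))" for p
  have even_le: "g p \<le> 1" if p: "1 \<le> p" "p \<le> h - 1" for p
  proof (rule log_convex_max_principle[OF _ _ _ _ p])
    show "0 \<le> g p" for p unfolding g_def f_def using Npos \<mu> by simp
    show "g 1 \<le> 1"
      using agree_count_endpoints(1)[OF h] Npos \<mu> by (simp add: g_def f_def N_def \<mu>_def numeral_2_eq_2)
    have "2 * (h - 1) = 2 * h - 2" "2 * (h - 1) - 1 = 2 * h - 3" by simp_all
    then show "g (h - 1) \<le> 1"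
      using agree_count_endpoints(2)[OF h] Npos \<mu> unfolding g_def f_def N_def \<mu>_def by simp
    fix p assume p: "1 < p" "p < h - 1"
    have "(f (2 * p))\<^sup>2 \<le> f (2 * (p - 1)) * f (2 * (p + 1))"
      using agree_count_log_convex[of "p - 1" h "p + 1"] p by (simp add: f_def mult_2)
    moreover have "(N * \<mu> ^ (2 * p - 1))\<^sup>2 = (N * \<mu> ^ (2 * (p - 1) - 1)) * (N * \<mu> ^ (2 * (p + 1) - 1))"
    proof -
      have "\<mu> ^ (2 * (p - 1) - 1) * \<mu> ^ (2 * (p + 1) - 1) = \<mu> ^ ((2 * p - 1) * 2)"
        unfolding power_add[symmetric] using p by (intro arg_cong[where f = "\<lambda>n. \<mu> ^ n"]) auto
      then show ?thesis by (simp add: power_mult_distrib power_mult power2_eq_square)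
    qed
    ultimately show "(g p)\<^sup>2 \<le> g (p - 1) * g (p + 1)"
      unfolding g_def power_divide times_divide_times_eq using Npos \<mu> by (simp add: divide_right_mono)
  qed
  have E: "f (2 * p) \<le> N * \<mu> ^ (2 * p - 1)" if "1 \<le> p" "p \<le> h - 1" for p
    using even_le[OF that] Npos \<mu> by (simp add: g_def)
  have "f q \<le> N * \<mu> ^ (q - 1)"
  proof (cases "even q")
    case True
    then obtain p where "q = 2 * p" by auto
    then show ?thesis using E[of p] q by auto
  next
    case False
    then obtain p where qp: "q = 2 * p + 1" by (metis oddE)
    consider "p = 0" | "p = h - 1" | "1 \<le> p" "p < h - 1" using q qp by linarith
    then show ?thesis
    proof cases
      case 1
      then show ?thesis using agree_count_values(2)[of h] h qp by (simp add: f_def N_def)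
    next
      case 2
      then have qk: "q = 2 * h - 1" using qp h by simp
      have "real (2 * agree_count (2 * h) h (2 * h - 1)) = N\<^sup>2"
        using agree_count_values(5)[of h] h by (simp add: N_def)
      then have "f q = N * (N / 2)" by (simp add: f_def qk power2_eq_square)
      moreover have "q - 1 = 2 * h - 2" using qk by simp
      moreover have "\<mu> ^ (2 * h - 2) = N / 2" using growth_power[of h] h by (simp add: N_def \<mu>_def)
      ultimately show ?thesis by (metis order_refl)
    next
      case 3
      have "(f q)\<^sup>2 \<le> f (2 * p) * f (2 * (p + 1))"
        using agree_count_log_convex[of p h "p + 1"] 3 qp by (simp add: f_def mult_2)
      also have "\<dots> \<le> (N * \<mu> ^ (2 * p - 1)) * (N * \<mu> ^ (2 * (p + 1) - 1))"
        using E[of p] E[of "p + 1"] 3 Npos \<mu> by (intro mult_mono) (auto simp: f_def)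
      also have "\<dots> = (N * \<mu> ^ (q - 1))\<^sup>2"
      proof -
        have "\<mu> ^ (2 * p - 1) * \<mu> ^ (2 * (p + 1) - 1) = \<mu> ^ ((q - 1) * 2)"
          unfolding power_add[symmetric] using 3 qp by (intro arg_cong[where f = "\<lambda>n. \<mu> ^ n"]) auto
        then show ?thesis by (simp add: power_mult_distrib power_mult power2_eq_square)
      qed
      finally show ?thesis by (rule power2_le_imp_le) (use Npos \<mu> in simp)
    qed
  qed
  then show ?thesis by (simp add: f_def N_def \<mu>_def)
qed

subsection \<open>Differences of balanced sets\<close>

definition balanced_sets :: "nat \<Rightarrow> nat set set" where
  "balanced_sets h = {a. a \<subseteq> {..<2 * h} \<and> card a = h}"

definition diff_vec :: "nat set \<Rightarrow> nat set \<Rightarrow> nat \<Rightarrow> real" where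
  "diff_vec a b = (\<lambda>i. of_bool (i \<in> a) - of_bool (i \<in> b))"

text \<open>The common size of the fibres of \<open>diff_vec\<close> over the ternary sum-zero
  vectors on \<open>{..<2 * h}\<close> with support of size \<open>n\<close>; zero where no such
  vector exists.\<close>

definition central_weight :: "nat \<Rightarrow> nat \<Rightarrow> real" where
  "central_weight h n = (if even n \<and> n \<le> 2 * h then real ((2 * h - n) choose (h - n div 2)) else 0)"

lemma finite_balanced_sets: "finite (balanced_sets h)"
  by (rule finite_subset[of _ "Pow {..<2 * h}"]) (auto simp: balanced_sets_def)

lemma card_balanced_sets: "card (balanced_sets h) = (2 * h) choose h"
  using n_subsets[of "{..<2 * h}" h] by (simp add: balanced_sets_def)

lemma diff_vec_ternary: "diff_vec a b \<in> ternary"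
  by (auto simp: ternary_def diff_vec_def)

lemma diff_vec_sum_zero:
  assumes "a \<in> balanced_sets h" "b \<in> balanced_sets h"
  shows "diff_vec a b \<in> sum_zero {..<2 * h}"
proof -
  have "(\<Sum>i<2 * h. of_bool (i \<in> a) :: real) = real h" if "a \<in> balanced_sets h" for a
  proof -
    have "(\<Sum>i<2 * h. of_bool (i \<in> a) :: real) = real (card ({..<2 * h} \<inter> a))"
      by (simp add: of_bool_def sum.If_cases)
    moreover have "{..<2 * h} \<inter> a = a" using that by (auto simp: balanced_sets_def)
    ultimately show ?thesis using that by (simp add: balanced_sets_def)
  qed
  then show ?thesis
    using assms by (auto simp: sum_zero_def fsupp_def diff_vec_def sum_subtractf balanced_sets_def)
qed

lemma central_weight_nonneg: "central_weight h n \<ge> 0"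
  by (simp add: central_weight_def)

text \<open>Consecutive central binomial coefficients grow at least by the factor 2. This is the
  decay needed when a merge cancels two coordinates of the support.\<close>

lemma central_weight_step: "2 * central_weight h (n + 2) \<le> central_weight h n"
proof (cases "even n \<and> n + 2 \<le> 2 * h")
  case True
  then obtain m where m: "n = 2 * m" by auto
  define g where "g = h - m - 1"
  have g: "2 * h - n = 2 * Suc g" "h - n div 2 = Suc g" "2 * h - (n + 2) = 2 * g" "h - (n + 2) div 2 = g"
    using True m by (auto simp: g_def)
  have "Suc g * (2 * ((2 * g) choose g)) \<le> 2 * (2 * g + 1) * ((2 * g) choose g)" by simp
  also have "\<dots> = Suc g * ((2 * Suc g) choose (Suc g))" by (rule central_binomial_Suc[symmetric])
  finally have "2 * ((2 * g) choose g) \<le> (2 * Suc g) choose (Suc g)" by (simp only: Suc_mult_le_cancel1)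
  then have "real (2 * ((2 * g) choose g)) \<le> real ((2 * Suc g) choose (Suc g))" by (rule of_nat_mono)
  then show ?thesis unfolding central_weight_def g using True by simp
next
  case False
  then show ?thesis by (auto simp: central_weight_def)
qed

text \<open>Positions of value 1 belong to \<open>a\<close> only, those of value -1 to
  \<open>b\<close> only, and they are equally many because \<open>v\<close> sums to zero. What
  remains free is \<open>a \<inter> b\<close>, off the support.\<close>

lemma card_diff_vec_fiber:
  assumes "v \<in> ternary" "v \<in> sum_zero {..<2 * h}"
  shows "real (card {(a, b) \<in> balanced_sets h \<times> balanced_sets h. diff_vec a b = v}) =
    central_weight h (card (fsupp v))"
proof -
  let ?K = "{..<2 * h}"
  define P where "P = {i. v i = 1}"
  define M where "M = {i. v i = -1}"
  define m where "m = card P"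
  have vi: "v i = 1 \<or> v i = 0 \<or> v i = -1" for i using assms(1) by (auto simp: ternary_def)
  have PM: "fsupp v = P \<union> M" "P \<inter> M = {}" using vi by (auto simp: fsupp_def P_def M_def)
  have sub: "P \<union> M \<subseteq> ?K" using assms(2) PM by (auto simp: sum_zero_def)
  then have fin: "finite P" "finite M" by (auto intro: finite_subset[of _ ?K])
  have "v i = of_bool (i \<in> P) - of_bool (i \<in> M)" for i
    using vi[of i] by (auto simp: P_def M_def)
  then have "sum v ?K = (\<Sum>i\<in>?K. of_bool (i \<in> P)) - (\<Sum>i\<in>?K. of_bool (i \<in> M))"
    by (simp add: sum_subtractf)
  also have "\<dots> = real (card (?K \<inter> P)) - real (card (?K \<inter> M))"
    by (simp add: of_bool_def sum.If_cases)
  also have "?K \<inter> P = P" using sub by auto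
  also have "?K \<inter> M = M" using sub by auto
  finally have cM: "card M = m" using assms(2) by (simp add: sum_zero_def m_def)
  have cs: "card (fsupp v) = 2 * m" using PM fin cM by (simp add: card_Un_disjoint m_def)
  have m: "m \<le> h" using card_mono[OF _ sub] cs PM by simp
  let ?C = "{c. c \<subseteq> ?K - fsupp v \<and> card c = h - m}"
  have "bij_betw (\<lambda>c. (P \<union> c, M \<union> c)) ?C
     {(a, b) \<in> balanced_sets h \<times> balanced_sets h. diff_vec a b = v}"
  proof (rule bij_betw_byWitness[where f' = "\<lambda>(a, b). a \<inter> b"])
    show "\<forall>c\<in>?C. (\<lambda>(a, b). a \<inter> b) (P \<union> c, M \<union> c) = c" using PM by auto
    show "\<forall>p\<in>{(a, b) \<in> balanced_sets h \<times> balanced_sets h. diff_vec a b = v}.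
       (P \<union> (\<lambda>(a, b). a \<inter> b) p, M \<union> (\<lambda>(a, b). a \<inter> b) p) = p"
      by (auto simp: P_def M_def diff_vec_def of_bool_def split: if_splits)
    show "(\<lambda>c. (P \<union> c, M \<union> c)) ` ?C \<subseteq> {(a, b) \<in> balanced_sets h \<times> balanced_sets h. diff_vec a b = v}"
    proof
      fix p assume "p \<in> (\<lambda>c. (P \<union> c, M \<union> c)) ` ?C"
      then obtain c where c: "p = (P \<union> c, M \<union> c)" "c \<subseteq> ?K - (P \<union> M)" "card c = h - m"
        using PM by auto
      have "finite c" using c by (auto intro: finite_subset[of _ ?K])
      moreover have dis: "P \<inter> c = {}" "M \<inter> c = {}" using c by auto
      ultimately have "card (P \<union> c) = h" "card (M \<union> c) = h"
        using fin c m cM by (auto simp: card_Un_disjoint m_def)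
      moreover have "diff_vec (P \<union> c) (M \<union> c) i = v i" for i
        using vi[of i] dis by (auto simp: diff_vec_def P_def M_def)
      ultimately show "p \<in> {(a, b) \<in> balanced_sets h \<times> balanced_sets h. diff_vec a b = v}"
        using c sub by (auto simp: balanced_sets_def)
    qed
    show "(\<lambda>(a, b). a \<inter> b) ` {(a, b) \<in> balanced_sets h \<times> balanced_sets h. diff_vec a b = v} \<subseteq> ?C"
    proof
      fix c assume "c \<in> (\<lambda>(a, b). a \<inter> b) ` {(a, b) \<in> balanced_sets h \<times> balanced_sets h. diff_vec a b = v}"
      then obtain a b where ab: "c = a \<inter> b" "a \<in> balanced_sets h" "diff_vec a b = v" by auto
      have "a = P \<union> c" "P \<inter> c = {}" "c \<inter> fsupp v = {}"
        using ab by (auto simp: P_def diff_vec_def fsupp_def of_bool_def split: if_splits)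
      moreover have "finite P" "finite c" using fin ab(1,2)
        by (auto simp: balanced_sets_def intro: finite_subset[of _ ?K])
      ultimately have "card a = card P + card c" by (simp add: card_Un_disjoint)
      then have "h = m + card c" using ab(2) by (simp add: balanced_sets_def m_def)
      then show "c \<in> ?C" using ab \<open>c \<inter> fsupp v = {}\<close> by (auto simp: balanced_sets_def)
    qed
  qed
  then have "card {(a, b) \<in> balanced_sets h \<times> balanced_sets h. diff_vec a b = v} = card ?C"
    by (rule bij_betw_same_card[symmetric])
  also have "\<dots> = (2 * h - 2 * m) choose (h - m)"
    using sub PM cs by (subst n_subsets) (auto simp: card_Diff_subset fin)
  finally show ?thesis using m cs by (simp add: central_weight_def)
qed

lemma card_diff_vec_in:
  assumes "L \<subseteq> sum_zero {..<2 * h}"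
  shows "real (card {(a, b) \<in> balanced_sets h \<times> balanced_sets h. diff_vec a b \<in> L}) =
    ternary_weight (central_weight h) L"
proof -
  let ?F = "\<lambda>v. {(a, b) \<in> balanced_sets h \<times> balanced_sets h. diff_vec a b = v}"
  have "{(a, b) \<in> balanced_sets h \<times> balanced_sets h. diff_vec a b \<in> L} = (\<Union>v \<in> L \<inter> ternary. ?F v)"
    using diff_vec_ternary by auto
  also have "card \<dots> = (\<Sum>v \<in> L \<inter> ternary. card (?F v))"
  proof (rule card_UN_disjoint)
    show "finite (L \<inter> ternary)" using finite_ternary_Int[OF _ assms] by simp
    show "\<forall>v \<in> L \<inter> ternary. finite (?F v)"
      by (auto intro: finite_subset[of _ "balanced_sets h \<times> balanced_sets h"] simp: finite_balanced_sets)
  qed auto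
  finally have "real (card {(a, b) \<in> balanced_sets h \<times> balanced_sets h. diff_vec a b \<in> L})
      = (\<Sum>v \<in> L \<inter> ternary. real (card (?F v)))" by simp
  also have "\<dots> = ternary_weight (central_weight h) L"
    unfolding ternary_weight_def using assms by (intro sum.cong refl card_diff_vec_fiber) auto
  finally show ?thesis .
qed

lemma subspace_sum_zero: "fvs.subspace (sum_zero S)"
  unfolding fvs.subspace_def
proof (intro conjI ballI allI)
  show "0 \<in> sum_zero S" by (simp add: sum_zero_def fsupp_def)
  show "u + v \<in> sum_zero S" if "u \<in> sum_zero S" "v \<in> sum_zero S" for u v
  proof -
    have "fsupp (u + v) \<subseteq> fsupp u \<union> fsupp v" by (auto simp: fsupp_def)
    then show ?thesis using that by (auto simp: sum_zero_def sum.distrib)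
  qed
  show "(\<lambda>i. c * v i) \<in> sum_zero S" if "v \<in> sum_zero S" for c v
    using that by (auto simp: sum_zero_def fsupp_def sum_distrib_left[symmetric])
qed

lemma sum_zero_mono:
  assumes "J \<subseteq> S" "finite S"
  shows "sum_zero J \<subseteq> sum_zero S"
proof
  fix v assume v: "v \<in> sum_zero J"
  then have "sum v S = sum v J"
    using assms by (intro sum.mono_neutral_right) (auto simp: sum_zero_def fsupp_def)
  then show "v \<in> sum_zero S" using v assms by (auto simp: sum_zero_def)
qed

text \<open>The merging argument is applied to the span of \<open>R\<close>, of which
  \<open>B\<close> is a basis, and the resulting \<open>sum_zero J\<close> is counted by
  \<open>agree_count\<close>. Since coordinate \<open>i\<close> is absent,
  \<open>card J \<le> 2 * h - 1\<close>, the range of \<open>agree_count_le\<close>.\<close>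

lemma card_diff_vec_le_growth:
  assumes h: "h \<ge> 3" and i: "i < 2 * h" and R: "finite R" "R \<subseteq> sum_zero ({..<2 * h} - {i})"
  shows "\<exists>B \<subseteq> R. fvs.independent B \<and> R \<subseteq> fvs.span B \<and>
    real (card {(a, b) \<in> balanced_sets h \<times> balanced_sets h. diff_vec a b \<in> R})
      \<le> real ((2 * h) choose h) * growth h ^ card B"
proof -
  let ?K = "{..<2 * h}" and ?S = "{..<2 * h} - {i}"
  let ?N = "real ((2 * h) choose h)"
  let ?pairs = "\<lambda>L. {(a, b) \<in> balanced_sets h \<times> balanced_sets h. diff_vec a b \<in> L}"
  define L where "L = fvs.span R"
  have LS: "L \<subseteq> sum_zero ?S" unfolding L_def using R subspace_sum_zero by (intro fvs.span_minimal) auto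
  have LK: "L \<subseteq> sum_zero ?K" using LS sum_zero_mono[of ?S ?K] by auto
  obtain J A where J: "J \<subseteq> ?S" "ternary_weight (central_weight h) L \<le> ternary_weight (central_weight h) (sum_zero J)"
    and A: "A \<subseteq> L" "fvs.independent A" "finite A" "card J \<le> card A + 1"
    using ternary_weight_le_sum_zero[of ?S L "central_weight h"] LS central_weight_nonneg central_weight_step
    by (auto simp: L_def fvs.subspace_span)
  obtain B where B: "B \<subseteq> R" "fvs.independent B" "R \<subseteq> fvs.span B"
    using fvs.maximal_independent_subset by blast
  have "fvs.span R \<subseteq> fvs.span B" using B(3) fvs.span_minimal fvs.subspace_span by blast
  then have "card A \<le> card B"
    using fvs.independent_span_bound[of B A] A B R(1) by (auto simp: L_def intro: finite_subset)
  then have JB: "card J - 1 \<le> card B" using A(4) by simp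
  have JK: "J \<subseteq> ?K" using J by auto
  have pairsJ: "?pairs (sum_zero J) = agree_pairs ?K J h h"
  proof (intro set_eqI iffI)
    fix p assume "p \<in> ?pairs (sum_zero J)"
    then obtain a b where p: "p = (a, b)" "a \<in> balanced_sets h" "b \<in> balanced_sets h"
      and supp: "fsupp (diff_vec a b) \<subseteq> J"
      by (auto simp: sum_zero_def)
    have "x \<in> a \<longleftrightarrow> x \<in> b" if "x \<notin> J" for x
      using supp that by (cases "x \<in> a"; cases "x \<in> b"; force simp: fsupp_def diff_vec_def)
    then have "a - J = b - J" by auto
    with p show "p \<in> agree_pairs ?K J h h" by (simp add: agree_pairs_def balanced_sets_def)
  next
    fix p assume "p \<in> agree_pairs ?K J h h"
    then obtain a b where p: "p = (a, b)" "a \<in> balanced_sets h" "b \<in> balanced_sets h" "a - J = b - J"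
      by (auto simp: agree_pairs_def balanced_sets_def)
    then have "fsupp (diff_vec a b) \<subseteq> J" by (auto simp: fsupp_def diff_vec_def split: if_splits)
    moreover have "sum (diff_vec a b) J = sum (diff_vec a b) ?K"
      using JK calculation by (intro sum.mono_neutral_left) (auto simp: fsupp_def)
    ultimately show "p \<in> ?pairs (sum_zero J)"
      using p diff_vec_sum_zero[of a h b] by (simp add: sum_zero_def)
  qed
  have "card J \<le> card ?S" using J by (intro card_mono) auto
  then have cJ: "card J \<le> 2 * h - 1" using i by simp
  have "real (card (?pairs R)) \<le> real (card (?pairs L))"
    using fvs.span_superset
    by (intro of_nat_mono card_mono finite_subset[of "?pairs L" "balanced_sets h \<times> balanced_sets h"])
       (auto simp: finite_balanced_sets L_def)
  also have "\<dots> = ternary_weight (central_weight h) L" by (rule card_diff_vec_in[OF LK])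
  also have "\<dots> \<le> ternary_weight (central_weight h) (sum_zero J)" by (rule J)
  also have "\<dots> = real (card (?pairs (sum_zero J)))"
    by (rule card_diff_vec_in[symmetric]) (use sum_zero_mono[OF JK] in auto)
  also have "\<dots> = real (agree_count (2 * h) h (card J))"
    unfolding pairsJ using card_agree_pairs[of ?K J h] JK by simp
  also have "\<dots> \<le> ?N * growth h ^ (card J - 1)"
  \<comment> \<open>The subtraction in \<open>card J - 1\<close> truncates when \<open>J\<close> is
    empty; there the count is the binomial coefficient itself.\<close>
  proof (cases "card J = 0")
    case True
    then show ?thesis using agree_count_values(1)[of h] h by simp
  next
    case False
    then show ?thesis using agree_count_le[OF h _ cJ] by simp
  qed
  also have "\<dots> \<le> ?N * growth h ^ card B"
    using JB growth_ge[OF h] by (intro mult_left_mono power_increasing) auto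
  finally show ?thesis using B by blast
qed

subsection \<open>Affine hashing\<close>

definition int_box :: "nat \<Rightarrow> nat \<Rightarrow> (nat \<Rightarrow> int) set" where
  "int_box m d = {..<m} \<rightarrow>\<^sub>E {0..<int d}"

lemma finite_int_box: "finite (int_box m d)"
  unfolding int_box_def by (intro finite_PiE) auto

lemma card_int_box: "card (int_box m d) = d ^ m"
  by (simp add: int_box_def card_funcsetE)

definition sphere_section :: "nat \<Rightarrow> nat \<Rightarrow> nat \<Rightarrow> (nat \<Rightarrow> int) set" where
  "sphere_section m d \<rho> = {b \<in> int_box m d. (\<Sum>t<m. (b t)\<^sup>2) = int \<rho>}"

text \<open>Pigeonhole over the at most \<open>m * d\<^sup>2 + 1\<close> values of the squared norm
  on the box.\<close>

lemma large_sphere_section: "\<exists>\<rho>. d ^ m \<le> card (sphere_section m d \<rho>) * (m * d\<^sup>2 + 1)"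
proof (rule ccontr)
  assume "\<not> ?thesis"
  then have small: "card (sphere_section m d \<rho>) * (m * d\<^sup>2 + 1) < d ^ m" for \<rho> by (simp add: not_le)
  have "int_box m d \<subseteq> (\<Union>\<rho>\<le>m * d\<^sup>2. sphere_section m d \<rho>)"
  proof
    fix b assume b: "b \<in> int_box m d"
    let ?s = "\<Sum>t<m. (b t)\<^sup>2"
    have "(b t)\<^sup>2 \<le> (int d)\<^sup>2" if "t < m" for t
      using b that by (intro power_mono) (auto simp: int_box_def PiE_iff Ball_def intro: less_imp_le)
    then have "?s \<le> (\<Sum>t<m. (int d)\<^sup>2)" by (intro sum_mono) auto
    then have "nat ?s \<le> m * d\<^sup>2" by (simp add: nat_le_iff)
    moreover have "b \<in> sphere_section m d (nat ?s)"
      using b by (simp add: sphere_section_def sum_nonneg)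
    ultimately show "b \<in> (\<Union>\<rho>\<le>m * d\<^sup>2. sphere_section m d \<rho>)" by blast
  qed
  then have "d ^ m \<le> card (\<Union>\<rho>\<le>m * d\<^sup>2. sphere_section m d \<rho>)"
    unfolding card_int_box[symmetric]
    by (intro card_mono) (auto simp: sphere_section_def finite_int_box)
  also have "\<dots> \<le> (\<Sum>\<rho>\<le>m * d\<^sup>2. card (sphere_section m d \<rho>))" by (rule card_UN_le) simp
  finally have "d ^ m * (m * d\<^sup>2 + 1) \<le> (\<Sum>\<rho>\<le>m * d\<^sup>2. card (sphere_section m d \<rho>)) * (m * d\<^sup>2 + 1)"
    by (rule mult_right_mono) simp
  also have "\<dots> = (\<Sum>\<rho>\<le>m * d\<^sup>2. card (sphere_section m d \<rho>) * (m * d\<^sup>2 + 1))"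
    by (simp only: sum_distrib_right)
  also have "\<dots> < (\<Sum>\<rho>\<le>m * d\<^sup>2. d ^ m)" using small by (intro sum_strict_mono) auto
  finally show False by simp
qed

text \<open>The points and their mean \<open>b\<close> have the same norm, so the squared distances
  from \<open>b\<close> add up to \<open>2 * l * \<rho> - 2 * l * \<rho> = 0\<close>.\<close>

lemma sphere_section_strictly_convex:
  assumes bs: "\<And>i. i < l \<Longrightarrow> bs i \<in> sphere_section m d \<rho>" and b: "b \<in> sphere_section m d \<rho>"
    and mean: "\<And>t. t < m \<Longrightarrow> (\<Sum>i<l. bs i t) = int l * b t" and i: "i < l"
  shows "bs i = b"
proof -
  have "(\<Sum>i<l. \<Sum>t<m. (bs i t - b t)\<^sup>2)
      = (\<Sum>i<l. (\<Sum>t<m. (bs i t)\<^sup>2) + (\<Sum>t<m. (b t)\<^sup>2) - 2 * (\<Sum>t<m. bs i t * b t))"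
    by (simp add: power2_diff sum.distrib sum_subtractf sum_distrib_left algebra_simps)
  also have "\<dots> = (\<Sum>i<l. 2 * int \<rho> - 2 * (\<Sum>t<m. bs i t * b t))"
    using bs b by (intro sum.cong) (auto simp: sphere_section_def)
  also have "\<dots> = 2 * int l * int \<rho> - 2 * (\<Sum>i<l. \<Sum>t<m. bs i t * b t)"
    by (simp add: sum_subtractf sum_distrib_left)
  also have "(\<Sum>i<l. \<Sum>t<m. bs i t * b t) = (\<Sum>t<m. \<Sum>i<l. bs i t * b t)" by (rule sum.swap)
  also have "\<dots> = (\<Sum>t<m. int l * (b t)\<^sup>2)"
    using mean by (intro sum.cong) (auto simp: sum_distrib_right[symmetric] power2_eq_square)
  also have "\<dots> = int l * int \<rho>" using b by (simp add: sum_distrib_left[symmetric] sphere_section_def)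
  finally have "(\<Sum>i<l. \<Sum>t<m. (bs i t - b t)\<^sup>2) = 0" by simp
  then have "(\<Sum>t<m. (bs i t - b t)\<^sup>2) = 0"
    using i by (simp add: sum_nonneg_eq_0_iff sum_nonneg)
  then have "bs i t = b t" if "t < m" for t using that by (simp add: sum_nonneg_eq_0_iff)
  then show ?thesis
    using bs[OF i] b by (intro PiE_ext[of _ "{..<m}" "\<lambda>_. {0..<int d}"]) (auto simp: sphere_section_def int_box_def)
qed

section \<open>Edges of the power and their linear hashes\<close>

text \<open>\<open>E j\<close> is the set of players whose letter at position \<open>j\<close> is 2,
  as \<open>encode_edge\<close> makes precise later; the vertex of player \<open>i\<close> is the
  word of truth values of \<open>i \<in> E j\<close>.\<close>

definition edge_funs :: "nat \<Rightarrow> nat \<Rightarrow> (nat \<Rightarrow> nat set) set" where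
  "edge_funs h n = {..<n} \<rightarrow>\<^sub>E balanced_sets h"

definition same_vertex :: "nat \<Rightarrow> nat \<Rightarrow> (nat \<Rightarrow> nat set) \<Rightarrow> (nat \<Rightarrow> nat set) \<Rightarrow> bool" where
  "same_vertex n i E E' \<longleftrightarrow> (\<forall>j<n. i \<in> E j \<longleftrightarrow> i \<in> E' j)"

lemma edge_funs_eqI:
  "E \<in> edge_funs h n \<Longrightarrow> E' \<in> edge_funs h n \<Longrightarrow> (\<And>j. j < n \<Longrightarrow> E j = E' j) \<Longrightarrow> E = E'"
  unfolding edge_funs_def by (rule PiE_ext) auto

lemma finite_edge_funs: "finite (edge_funs h n)"
  unfolding edge_funs_def by (intro finite_PiE) (auto simp: finite_balanced_sets)

lemma card_edge_funs: "card (edge_funs h n) = ((2 * h) choose h) ^ n"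
  by (simp add: edge_funs_def card_funcsetE card_balanced_sets)

definition hash :: "nat \<Rightarrow> (nat \<Rightarrow> nat \<Rightarrow> int) \<Rightarrow> (nat \<Rightarrow> nat set) \<Rightarrow> nat \<Rightarrow> nat \<Rightarrow> int" where
  "hash n w E i t = (\<Sum>j<n. of_bool (i \<in> E j) * w j t)"

lemma hash_same_vertex: "same_vertex n i E E' \<Longrightarrow> hash n w E i t = hash n w E' i t"
  by (simp add: hash_def same_vertex_def)

text \<open>Every column contains exactly \<open>h\<close> players, so the total over all players
  does not depend on the edge. Hence the hashes of the other players determine that of the last
  one.\<close>

lemma sum_hash:
  assumes "E \<in> edge_funs h n"
  shows "(\<Sum>i<2 * h. hash n w E i t) = int h * (\<Sum>j<n. w j t)"
proof -
  have "(\<Sum>i<2 * h. hash n w E i t) = (\<Sum>j<n. (\<Sum>i<2 * h. of_bool (i \<in> E j)) * w j t)"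
    unfolding hash_def by (subst sum.swap) (simp add: sum_distrib_right)
  also have "\<dots> = (\<Sum>j<n. int h * w j t)"
  proof (intro sum.cong refl)
    fix j assume "j \<in> {..<n}"
    then have Ej: "E j \<subseteq> {..<2 * h}" "card (E j) = h"
      using assms by (auto simp: edge_funs_def balanced_sets_def PiE_iff Ball_def)
    have "(\<Sum>i<2 * h. of_bool (i \<in> E j) :: int) = int (card ({..<2 * h} \<inter> E j))"
      by (simp add: of_bool_def sum.If_cases)
    also have "{..<2 * h} \<inter> E j = E j" using Ej by auto
    finally show "(\<Sum>i<2 * h. of_bool (i \<in> E j)) * w j t = int h * w j t" using Ej by simp
  qed
  finally show ?thesis by (simp add: sum_distrib_left)
qed

lemma hash_bounds:
  assumes "w \<in> {..<n} \<rightarrow>\<^sub>E int_box m d" "t < m"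
  shows "0 \<le> hash n w E i t" "hash n w E i t \<le> int (n * d)"
proof -
  have w: "0 \<le> w j t" "w j t \<le> int d" if "j < n" for j
    using assms that by (auto simp: int_box_def PiE_iff Ball_def intro: less_imp_le)
  show "0 \<le> hash n w E i t" unfolding hash_def using w by (intro sum_nonneg) auto
  have "hash n w E i t \<le> (\<Sum>j<n. int d)" unfolding hash_def using w by (intro sum_mono) auto
  then show "hash n w E i t \<le> int (n * d)" by simp
qed

text \<open>If two colliding weights agree off a set of positions with independent columns, their
  difference gives a linear relation among those columns, so they are equal. Only
  \<open>n - card B\<close> positions remain free.\<close>

lemma card_hash_collisions:
  assumes E: "E \<in> edge_funs h n" "E' \<in> edge_funs h n"
    and B: "B \<subseteq> (\<lambda>j. diff_vec (E j) (E' j)) ` {..<n}" "fvs.independent B"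
  shows "card {w \<in> {..<n} \<rightarrow>\<^sub>E int_box m d. \<forall>i<2 * h. \<forall>t<m. hash n w E i t = hash n w E' i t}
    \<le> (d ^ m) ^ (n - card B)"
proof -
  let ?D = "\<lambda>j. diff_vec (E j) (E' j)"
  let ?W = "{w \<in> {..<n} \<rightarrow>\<^sub>E int_box m d. \<forall>i<2 * h. \<forall>t<m. hash n w E i t = hash n w E' i t}"
  obtain J where J: "J \<subseteq> {..<n}" "inj_on ?D J" "B = ?D ` J"
    using B(1) by (meson subset_image_inj)
  have finJ: "finite J" using J finite_subset by blast
  have inv: "inv_into J ?D (diff_vec (E j) (E' j)) = j" if "j \<in> J" for j
    using inv_into_f_f[OF J(2) that] .
  have cJ: "card J = card B" using J by (simp add: card_image)
  have inj: "inj_on (\<lambda>w. restrict w ({..<n} - J)) ?W"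
  proof (rule inj_onI)
    fix w w' assume w: "w \<in> ?W" "w' \<in> ?W" and eq: "restrict w ({..<n} - J) = restrict w' ({..<n} - J)"
    have off: "w j = w' j" if "j < n" "j \<notin> J" for j using fun_cong[OF eq, of j] that by simp
    have on: "w j t = w' j t" if j: "j \<in> J" and t: "t < m" for j t
    proof -
      define c where "c = (\<lambda>j. real_of_int (w j t - w' j t))"
      have "(\<Sum>j\<in>J. c j * ?D j i) = 0" for i
      proof (cases "i < 2 * h")
        case False
        then have "?D j i = 0" if "j < n" for j
          using that E by (auto simp: diff_vec_def edge_funs_def balanced_sets_def PiE_iff Ball_def)
        then show ?thesis using J by (intro sum.neutral) auto
      next
        case True
        have "real_of_int (hash n v E i t - hash n v E' i t) = (\<Sum>j<n. real_of_int (v j t) * ?D j i)" for v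
          unfolding hash_def sum_subtractf[symmetric] of_int_sum
          by (intro sum.cong refl) (simp add: diff_vec_def)
        then have "(\<Sum>j<n. real_of_int (w j t) * ?D j i) = 0" "(\<Sum>j<n. real_of_int (w' j t) * ?D j i) = 0"
          using w True t by (metis (mono_tags, lifting) cancel_comm_monoid_add_class.diff_cancel mem_Collect_eq of_int_0)+
        then have "(\<Sum>j<n. c j * ?D j i) = 0"
          by (simp add: c_def left_diff_distrib sum_subtractf)
        moreover have "(\<Sum>j\<in>J. c j * ?D j i) = (\<Sum>j<n. c j * ?D j i)"
          using J off by (intro sum.mono_neutral_left) (auto simp: c_def)
        ultimately show ?thesis by simp
      qed
      then have "(\<Sum>j\<in>J. (\<lambda>i. c j * ?D j i)) = 0" by (auto simp: fun_eq_iff sum_fun_apply)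
      then have "(\<Sum>v\<in>B. (\<lambda>i. c (inv_into J ?D v) * v i)) = 0"
        unfolding J(3) sum.reindex[OF J(2)] o_def using inv
        by (subst sum.cong[OF refl, of J _ "\<lambda>j i. c j * ?D j i"]) auto
      then have "c (inv_into J ?D (?D j)) = 0"
        using B(2) fvs.independentD[of B B "\<lambda>v. c (inv_into J ?D v)" "?D j"] finJ J j by auto
      then show ?thesis using inv[OF j] by (simp add: c_def)
    qed
    have "w j = w' j" if j: "j < n" for j
    proof (cases "j \<in> J")
      case True
      have "w j \<in> int_box m d" "w' j \<in> int_box m d" using w j by auto
      then show ?thesis unfolding int_box_def
        by (rule PiE_ext) (use on[OF True] in auto)
    qed (use off j in auto)
    then show "w = w'" using w by (intro PiE_ext[of w "{..<n}" "\<lambda>_. int_box m d" w']) auto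
  qed
  have "(\<lambda>w. restrict w ({..<n} - J)) ` ?W \<subseteq> ({..<n} - J) \<rightarrow>\<^sub>E int_box m d" by auto
  then have "card ?W \<le> card (({..<n} - J) \<rightarrow>\<^sub>E int_box m d)"
    by (rule card_inj_on_le[OF inj]) (intro finite_PiE; simp add: finite_int_box)
  also have "\<dots> = (d ^ m) ^ (n - card B)"
    using J finJ cJ by (simp add: card_funcsetE card_int_box card_Diff_subset)
  finally show ?thesis .
qed

section \<open>Survivors of a random hash\<close>

locale hashing =
  fixes h n m d \<rho> :: nat
  assumes h: "h \<ge> 3" and d: "d \<ge> 1"
begin

abbreviation "weights \<equiv> {..<n} \<rightarrow>\<^sub>E int_box m d"
text \<open>The interval contains every \<open>b t - hash n w E i t\<close> and has
  \<open>(n + 1) * d\<close> elements.\<close>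

abbreviation "shifts \<equiv> {..<2 * h - 1} \<rightarrow>\<^sub>E ({..<m} \<rightarrow>\<^sub>E {- int (n * d)..<int d})"
abbreviation "targets \<equiv> sphere_section m d \<rho>"

text \<open>The last player has no shift and is not tested: \<open>hits_sum\<close> already ties its
  hash to \<open>b\<close>, the weights and the shifts.\<close>

definition hits :: "(nat \<Rightarrow> nat \<Rightarrow> int) \<Rightarrow> (nat \<Rightarrow> nat \<Rightarrow> int) \<Rightarrow> (nat \<Rightarrow> nat set) \<Rightarrow> (nat \<Rightarrow> int) \<Rightarrow> bool"
  where "hits w u E b \<longleftrightarrow> (\<forall>i<2 * h - 1. \<forall>t<m. hash n w E i t + u i t = b t)"

definition surviving :: "(nat \<Rightarrow> nat \<Rightarrow> int) \<Rightarrow> (nat \<Rightarrow> nat \<Rightarrow> int) \<Rightarrow> (nat \<Rightarrow> nat set) set"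
  where "surviving w u = {E \<in> edge_funs h n. \<exists>b\<in>targets. hits w u E b}"

definition touching :: "((nat \<Rightarrow> nat set) \<times> (nat \<Rightarrow> nat set)) set" where
  "touching = {(E, E') \<in> edge_funs h n \<times> edge_funs h n. E \<noteq> E' \<and> (\<exists>i<2 * h. same_vertex n i E E')}"

definition isolated :: "(nat \<Rightarrow> nat \<Rightarrow> int) \<Rightarrow> (nat \<Rightarrow> nat \<Rightarrow> int) \<Rightarrow> (nat \<Rightarrow> nat set) set"
  where "isolated w u =
    {E \<in> surviving w u. \<forall>E'\<in>surviving w u. (\<exists>i<2 * h. same_vertex n i E E') \<longrightarrow> E' = E}"

definition collisions :: "(nat \<Rightarrow> nat set) \<Rightarrow> (nat \<Rightarrow> nat set) \<Rightarrow> (nat \<Rightarrow> nat \<Rightarrow> int) set" where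
  "collisions E E' = {w \<in> weights. \<forall>i<2 * h. \<forall>t<m. hash n w E i t = hash n w E' i t}"

text \<open>The only shift under which \<open>E\<close> hits \<open>b\<close> for the weights
  \<open>w\<close>, for \<open>b\<close> in \<open>targets\<close>; \<open>restrict\<close> makes it
  extensional, so that it can be compared with elements of \<open>shifts\<close>.\<close>

definition shift :: "(nat \<Rightarrow> nat set) \<Rightarrow> (nat \<Rightarrow> nat \<Rightarrow> int) \<Rightarrow> (nat \<Rightarrow> int) \<Rightarrow> nat \<Rightarrow> nat \<Rightarrow> int" where
  "shift E w b = (\<lambda>i\<in>{..<2 * h - 1}. \<lambda>t\<in>{..<m}. b t - hash n w E i t)"

lemma targets_box: "b \<in> targets \<Longrightarrow> b \<in> {..<m} \<rightarrow>\<^sub>E {0..<int d}"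
  by (simp add: sphere_section_def int_box_def)

lemma finite_targets: "finite targets"
  by (rule finite_subset[OF _ finite_int_box]) (auto simp: sphere_section_def)

lemma finite_weights: "finite weights"
  by (intro finite_PiE) (auto simp: finite_int_box)

lemma finite_shifts: "finite shifts"
  by (intro finite_PiE) auto

lemma card_weights: "card weights = (d ^ m) ^ n"
  by (simp add: card_funcsetE card_int_box)

lemma card_shifts: "card shifts = (((n + 1) * d) ^ m) ^ (2 * h - 1)"
  by (simp add: card_funcsetE nat_add_distrib nat_mult_distrib algebra_simps)

lemma hits_iff: "u \<in> shifts \<Longrightarrow> hits w u E b \<longleftrightarrow> u = shift E w b"
proof
  assume u: "u \<in> shifts" and hit: "hits w u E b"
  show "u = shift E w b"
  proof (rule ext)
    fix i
    show "u i = shift E w b i"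
    proof (cases "i < 2 * h - 1")
      case True
      then have ui: "u i \<in> {..<m} \<rightarrow>\<^sub>E {- int (n * d)..<int d}" using u by auto
      show ?thesis
      proof (rule ext)
        fix t
        have "u i t = b t - hash n w E i t" if "t < m"
          using hit True that by (auto simp: hits_def algebra_simps)
        moreover have "u i t = undefined" if "\<not> t < m" using ui that by (auto simp: PiE_def extensional_def)
        ultimately show "u i t = shift E w b i t" using True by (auto simp: shift_def)
      qed
    next
      case False
      then have "u i = undefined" using u by (auto simp: PiE_def extensional_def)
      then show ?thesis using False by (simp add: shift_def)
    qed
  qed
qed (auto simp: hits_def shift_def)

lemma shift_in_shifts:
  assumes "w \<in> weights" "b \<in> targets"
  shows "shift E w b \<in> shifts"
  unfolding shift_def
proof (intro restrict_PiE_iff[THEN iffD2] ballI)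
  fix i t assume t: "t \<in> {..<m}"
  have "b t \<in> {0..<int d}" using PiE_mem[OF targets_box[OF assms(2)] t] .
  moreover have "0 \<le> hash n w E i t" "hash n w E i t \<le> int (n * d)"
    using hash_bounds[OF assms(1), of t E i] t by simp_all
  ultimately show "b t - hash n w E i t \<in> {- int (n * d)..<int d}"
    unfolding atLeastLessThan_iff by linarith
qed

text \<open>Sum the hit equations and eliminate the tested hashes by \<open>sum_hash\<close>. The
  right-hand side is an affine function of the last player's vertex alone, and divided by
  \<open>2 * h - 1\<close> it serves as that player's affine hash.\<close>

lemma hits_sum:
  assumes "E \<in> edge_funs h n" "hits w u E b" "t < m"
  shows "int (2 * h - 1) * b t =
    int h * (\<Sum>j<n. w j t) - hash n w E (2 * h - 1) t + (\<Sum>i<2 * h - 1. u i t)"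
proof -
  have "int (2 * h - 1) * b t = (\<Sum>i<2 * h - 1. hash n w E i t + u i t)"
    using assms(2,3) by (simp add: hits_def)
  also have "\<dots> = (\<Sum>i<2 * h - 1. hash n w E i t) + (\<Sum>i<2 * h - 1. u i t)" by (rule sum.distrib)
  also have "(\<Sum>i<2 * h - 1. hash n w E i t) = (\<Sum>i<2 * h. hash n w E i t) - hash n w E (2 * h - 1) t"
  proof -
    have "2 * h = Suc (2 * h - 1)" using h by simp
    then show ?thesis by (metis add_diff_cancel_right' sum.lessThan_Suc)
  qed
  finally show ?thesis using sum_hash[OF assms(1), of w t] by simp
qed

text \<open>The target can be read off the vertex of any single player: directly for a tested
  player, through \<open>hits_sum\<close> for the last one.\<close>

lemma surviving_touching_same_target:
  assumes E: "E \<in> edge_funs h n" "E' \<in> edge_funs h n" and b: "b \<in> targets" "b' \<in> targets"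
    and hit: "hits w u E b" "hits w u E' b'" and i: "i < 2 * h" "same_vertex n i E E'"
  shows "b = b'"
proof -
  have "b t = b' t" if t: "t < m" for t
  proof (cases "i < 2 * h - 1")
    case True
    then show ?thesis using hit t hash_same_vertex[OF i(2)] by (metis hits_def)
  next
    case False
    then have "i = 2 * h - 1" using i by simp
    then have "int (2 * h - 1) * b t = int (2 * h - 1) * b' t"
      using hits_sum[OF E(1) hit(1) t] hits_sum[OF E(2) hit(2) t] hash_same_vertex[OF i(2)] by simp
    then show ?thesis using h by (simp add: mult_cancel_left)
  qed
  then show ?thesis by (intro PiE_ext[OF targets_box[OF b(1)] targets_box[OF b(2)]]) auto
qed

text \<open>The vertices of \<open>E\<close> come from isolated edges \<open>F i\<close> with
  targets \<open>bs i\<close>. The targets of the tested players average to that of the last player,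
  so strict convexity makes them all equal and \<open>E\<close> survives. Sharing the vertex of
  player 0 with the isolated \<open>F 0\<close>, it equals \<open>F 0\<close>.\<close>

lemma isolated_induced:
  assumes E: "E \<in> edge_funs h n" and ex: "\<And>i. i < 2 * h \<Longrightarrow> \<exists>E'\<in>isolated w u. same_vertex n i E E'"
  shows "E \<in> isolated w u"
proof -
  from ex obtain F where F: "\<And>i. i < 2 * h \<Longrightarrow> F i \<in> isolated w u"
    "\<And>i. i < 2 * h \<Longrightarrow> same_vertex n i E (F i)" by metis
  then have "\<exists>b\<in>targets. hits w u (F i) b" if "i < 2 * h" for i
    using that by (auto simp: isolated_def surviving_def)
  then obtain bs where bs: "\<And>i. i < 2 * h \<Longrightarrow> bs i \<in> targets" "\<And>i. i < 2 * h \<Longrightarrow> hits w u (F i) (bs i)"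
    by metis
  let ?l = "2 * h - 1"
  have l: "?l < 2 * h" using h by simp
  have hash_eq: "hash n w E i t + u i t = bs i t" if "i < ?l" "t < m" for i t
    using bs(2)[of i] that hash_same_vertex[OF F(2), of i w t] by (auto simp: hits_def)
  have "bs i = bs ?l" if "i < ?l" for i
  proof (rule sphere_section_strictly_convex[where l = ?l])
    show "bs j \<in> sphere_section m d \<rho>" if "j < ?l" for j using bs(1) that by simp
    show "bs ?l \<in> sphere_section m d \<rho>" using bs(1) l by simp
    fix t assume t: "t < m"
    have Fl: "F ?l \<in> edge_funs h n" using F(1)[OF l] by (auto simp: isolated_def surviving_def)
    have "2 * h = Suc ?l" using h by simp
    then have "(\<Sum>i<?l. hash n w E i t) + hash n w E ?l t = int h * (\<Sum>j<n. w j t)"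
      using sum_hash[OF E, of w t] by (metis sum.lessThan_Suc)
    moreover have "(\<Sum>i<?l. bs i t) = (\<Sum>i<?l. hash n w E i t) + (\<Sum>i<?l. u i t)"
      unfolding sum.distrib[symmetric] using hash_eq t by (intro sum.cong) auto
    moreover have "hash n w E ?l t = hash n w (F ?l) ?l t" using hash_same_vertex[OF F(2)[OF l]] by simp
    ultimately show "(\<Sum>i<?l. bs i t) = int ?l * bs ?l t"
      using hits_sum[OF Fl bs(2)[OF l] t] by linarith
  qed (use that in auto)
  then have "hits w u E (bs ?l)" using hash_eq by (auto simp: hits_def)
  then have surv: "E \<in> surviving w u" using E bs(1)[OF l] by (auto simp: surviving_def)
  have "same_vertex n 0 (F 0) E" using F(2)[of 0] h by (auto simp: same_vertex_def)
  then have "E = F 0" using F(1)[of 0] surv h by (force simp: isolated_def)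
  then show ?thesis using F(1)[of 0] h by simp
qed

lemma isolated_matching:
  assumes "E \<in> isolated w u" "E' \<in> isolated w u" "E \<noteq> E'" "i < 2 * h"
  shows "\<not> same_vertex n i E E'"
  using assms by (auto simp: isolated_def)

text \<open>Deletion method: a survivor that is not isolated is the first entry of a touching pair
  of survivors.\<close>

lemma card_surviving_le_isolated:
  "card (surviving w u) \<le> card (isolated w u) + card {p \<in> touching. fst p \<in> surviving w u \<and> snd p \<in> surviving w u}"
proof -
  let ?T = "{p \<in> touching. fst p \<in> surviving w u \<and> snd p \<in> surviving w u}"
  have fs: "finite (surviving w u)"
    by (rule finite_subset[OF _ finite_edge_funs[of h n]]) (auto simp: surviving_def)
  have ft: "finite ?T"
    by (rule finite_subset[of _ "surviving w u \<times> surviving w u"]) (auto simp: fs)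
  have "surviving w u \<subseteq> isolated w u \<union> fst ` ?T"
  proof
    fix E assume E: "E \<in> surviving w u"
    show "E \<in> isolated w u \<union> fst ` ?T"
    proof (cases "E \<in> isolated w u")
      case False
      then obtain E' where "E' \<in> surviving w u" "E' \<noteq> E" "\<exists>i<2 * h. same_vertex n i E E'"
        using E by (auto simp: isolated_def)
      then have "(E, E') \<in> ?T" using E by (auto simp: touching_def surviving_def)
      then show ?thesis by force
    qed auto
  qed
  then have "card (surviving w u) \<le> card (isolated w u \<union> fst ` ?T)"
    using fs ft by (intro card_mono) (auto simp: isolated_def)
  also have "\<dots> \<le> card (isolated w u) + card (fst ` ?T)" by (rule card_Un_le)
  also have "card (fst ` ?T) \<le> card ?T" using ft by (rule card_image_le)
  finally show ?thesis by simp
qed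

text \<open>Weights and a target are completed by the shift \<open>shift E w b\<close>, and the
  target can be recovered from the part of that shift belonging to player 0.\<close>

lemma card_hashes_surviving:
  assumes E: "E \<in> edge_funs h n"
  shows "card weights * card targets \<le> card {p \<in> weights \<times> shifts. E \<in> surviving (fst p) (snd p)}"
proof -
  let ?f = "\<lambda>(w, b). (w, shift E w b)"
  have inj: "inj_on ?f (weights \<times> targets)"
  proof (rule inj_onI)
    fix p p' assume p: "p \<in> weights \<times> targets" "p' \<in> weights \<times> targets" "?f p = ?f p'"
    obtain w b w' b' where wb: "p = (w, b)" "p' = (w', b')" by fastforce
    have "w = w'" and eq: "shift E w b = shift E w' b'" using p(3) wb by auto
    have "b t = b' t" if "t < m" for t
      using fun_cong[OF fun_cong[OF eq, of 0], of t] that h \<open>w = w'\<close> by (simp add: shift_def)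
    then have "b = b'"
      using p wb by (intro PiE_ext[OF targets_box targets_box]) auto
    then show "p = p'" using wb \<open>w = w'\<close> by simp
  qed
  have "?f ` (weights \<times> targets) \<subseteq> {p \<in> weights \<times> shifts. E \<in> surviving (fst p) (snd p)}"
  proof
    fix q assume "q \<in> ?f ` (weights \<times> targets)"
    then obtain w b where q: "q = (w, shift E w b)" "w \<in> weights" "b \<in> targets" by auto
    then have s: "shift E w b \<in> shifts" using shift_in_shifts by blast
    then have "hits w (shift E w b) E b" by (simp add: hits_iff)
    then show "q \<in> {p \<in> weights \<times> shifts. E \<in> surviving (fst p) (snd p)}"
      using q s E by (auto simp: surviving_def)
  qed
  moreover have "finite {p \<in> weights \<times> shifts. E \<in> surviving (fst p) (snd p)}"
    using finite_weights finite_shifts by simp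
  ultimately have "card (weights \<times> targets) \<le> card {p \<in> weights \<times> shifts. E \<in> surviving (fst p) (snd p)}"
    using card_inj_on_le[OF inj] by blast
  then show ?thesis by (simp add: card_cartesian_product)
qed

text \<open>Both edges hit the same target, so every player, the last one by
  \<open>hits_sum\<close>, has equal hashes on them. The weights therefore collide, and together
  with the target they determine the shift.\<close>

lemma card_hashes_touching:
  assumes "(E, E') \<in> touching"
  shows "card {p \<in> weights \<times> shifts. E \<in> surviving (fst p) (snd p) \<and> E' \<in> surviving (fst p) (snd p)}
    \<le> card (collisions E E') * card targets"
proof -
  let ?f = "\<lambda>(w, b). (w, shift E w b)"
  let ?P = "{p \<in> weights \<times> shifts. E \<in> surviving (fst p) (snd p) \<and> E' \<in> surviving (fst p) (snd p)}"
  obtain i where i: "i < 2 * h" "same_vertex n i E E'" and E: "E \<in> edge_funs h n" "E' \<in> edge_funs h n"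
    using assms by (auto simp: touching_def)
  have fin: "finite (collisions E E' \<times> targets)"
    using finite_weights finite_targets by (simp add: collisions_def)
  have "?P \<subseteq> ?f ` (collisions E E' \<times> targets)"
  proof
    fix p assume "p \<in> ?P"
    then obtain w u b b' where p: "p = (w, u)" "w \<in> weights" "u \<in> shifts" "b \<in> targets" "b' \<in> targets"
      "hits w u E b" "hits w u E' b'" by (auto simp: surviving_def)
    have bb: "b = b'" by (rule surviving_touching_same_target[OF E p(4-7) i])
    have "hash n w E l t = hash n w E' l t" if l: "l < 2 * h" and t: "t < m" for l t
    proof (cases "l < 2 * h - 1")
      case True
      then have "hash n w E l t + u l t = hash n w E' l t + u l t"
        using p(6,7) bb t by (simp add: hits_def)
      then show ?thesis by simp
    next
      case False
      then have "l = 2 * h - 1" using l by simp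
      then show ?thesis using hits_sum[OF E(1) p(6) t] hits_sum[OF E(2) p(7) t] bb by simp
    qed
    then have "w \<in> collisions E E'" using p by (auto simp: collisions_def)
    moreover have "u = shift E w b" using p hits_iff by blast
    ultimately show "p \<in> ?f ` (collisions E E' \<times> targets)" using p by auto
  qed
  then have "card ?P \<le> card (?f ` (collisions E E' \<times> targets))" using fin by (intro card_mono) auto
  also have "\<dots> \<le> card (collisions E E' \<times> targets)" using fin by (rule card_image_le)
  finally show ?thesis by (simp add: card_cartesian_product)
qed

end

section \<open>Counting touching pairs by their difference columns\<close>

text \<open>A finite family containing every set of columns of a touching pair. Its size depends on
  \<open>h\<close> only, so splitting by pattern costs a factor independent of
  \<open>n\<close>.\<close>

definition column_patterns :: "nat \<Rightarrow> (nat \<Rightarrow> real) set set" where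
  "column_patterns h = Pow {v \<in> ternary. fsupp v \<subseteq> {..<2 * h}}"

lemma finite_column_patterns: "finite (column_patterns h)"
  unfolding column_patterns_def using finite_ternary_supp[of "{..<2 * h}"] by simp

lemma card_column_patterns_pos: "card (column_patterns h) > 0"
proof -
  have "{} \<in> column_patterns h" by (simp add: column_patterns_def)
  then show ?thesis using finite_column_patterns[of h] by (auto simp: card_gt_0_iff)
qed

definition columns :: "nat \<Rightarrow> (nat \<Rightarrow> nat set) \<times> (nat \<Rightarrow> nat set) \<Rightarrow> (nat \<Rightarrow> real) set" where
  "columns n p = (\<lambda>j. diff_vec (fst p j) (snd p j)) ` {..<n}"

text \<open>At each of the \<open>n\<close> positions the two edges show one of the pairs with
  difference in \<open>R\<close>, and these \<open>n\<close> pairs determine both edges.\<close>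

lemma card_pairs_with_columns:
  "card {p \<in> edge_funs h n \<times> edge_funs h n. columns n p = R}
    \<le> card {(a, b) \<in> balanced_sets h \<times> balanced_sets h. diff_vec a b \<in> R} ^ n"
proof -
  let ?P = "{(a, b) \<in> balanced_sets h \<times> balanced_sets h. diff_vec a b \<in> R}"
  let ?Q = "{p \<in> edge_funs h n \<times> edge_funs h n. columns n p = R}"
  let ?f = "\<lambda>p. \<lambda>j\<in>{..<n}. (fst p j, snd p j)"
  have finP: "finite ?P"
    by (rule finite_subset[of _ "balanced_sets h \<times> balanced_sets h"]) (auto simp: finite_balanced_sets)
  have inj: "inj_on ?f ?Q"
  proof (rule inj_onI)
    fix p q assume p: "p \<in> ?Q" "q \<in> ?Q" "?f p = ?f q"
    have "fst p j = fst q j \<and> snd p j = snd q j" if "j < n" for j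
      using fun_cong[OF p(3), of j] that by simp
    then have "fst p = fst q" "snd p = snd q"
      using p(1,2) by (auto intro!: edge_funs_eqI[of _ h n])
    then show "p = q" by (rule prod_eqI)
  qed
  have "?f ` ?Q \<subseteq> {..<n} \<rightarrow>\<^sub>E ?P"
  proof
    fix g assume "g \<in> ?f ` ?Q"
    then obtain p where p: "g = ?f p" "p \<in> edge_funs h n \<times> edge_funs h n" "columns n p = R" by auto
    have "(fst p j, snd p j) \<in> ?P" if "j < n" for j
      using p that by (auto simp: edge_funs_def columns_def PiE_iff)
    then show "g \<in> {..<n} \<rightarrow>\<^sub>E ?P" unfolding p(1) by (auto simp: restrict_PiE_iff)
  qed
  then have "card ?Q \<le> card ({..<n} \<rightarrow>\<^sub>E ?P)"
    by (rule card_inj_on_le[OF inj]) (intro finite_PiE finP; simp)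
  then show ?thesis by (simp add: card_funcsetE)
qed

context hashing
begin

text \<open>The shared player supplies the vanishing coordinate that
  \<open>card_diff_vec_le_growth\<close> asks for, and a nonzero column supplies rank at least
  one.\<close>

lemma columns_touching:
  assumes "p \<in> touching"
  shows "\<exists>i<2 * h. columns n p \<subseteq> sum_zero ({..<2 * h} - {i})" "\<not> columns n p \<subseteq> {0}"
    "columns n p \<in> column_patterns h"
proof -
  obtain E E' i where p: "p = (E, E')" "E \<in> edge_funs h n" "E' \<in> edge_funs h n" "E \<noteq> E'"
    "i < 2 * h" "same_vertex n i E E'" using assms by (auto simp: touching_def)
  have bal: "E j \<in> balanced_sets h" "E' j \<in> balanced_sets h" if "j < n" for j
    using p that by (auto simp: edge_funs_def)
  have "diff_vec (E j) (E' j) \<in> sum_zero ({..<2 * h} - {i})" if j: "j < n" for j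
  proof -
    have z: "diff_vec (E j) (E' j) i = 0" using p(6) j by (simp add: diff_vec_def same_vertex_def)
    then show ?thesis using diff_vec_sum_zero[OF bal(1,2)[OF j]] p(5)
      by (auto simp: sum_zero_def fsupp_def sum_diff1)
  qed
  then show "\<exists>i<2 * h. columns n p \<subseteq> sum_zero ({..<2 * h} - {i})"
    using p by (auto simp: columns_def)
  show "columns n p \<in> column_patterns h"
    using diff_vec_sum_zero[OF bal] diff_vec_ternary p
    by (auto simp: column_patterns_def columns_def sum_zero_def)
  show "\<not> columns n p \<subseteq> {0}"
  proof
    assume 0: "columns n p \<subseteq> {0}"
    have "E j = E' j" if "j < n" for j
    proof -
      have "diff_vec (E j) (E' j) = 0" using 0 p that by (auto simp: columns_def)
      then have 0: "diff_vec (E j) (E' j) x = 0" for x by simp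
      have "x \<in> E j \<longleftrightarrow> x \<in> E' j" for x
        using 0[of x] by (cases "x \<in> E j"; cases "x \<in> E' j") (simp_all add: diff_vec_def)
      then show ?thesis by blast
    qed
    then have "E = E'" by (rule edge_funs_eqI[OF p(2,3)])
    then show False using p by simp
  qed
qed

text \<open>Write \<open>D = d ^ m\<close>, \<open>K\<close> for the number of patterns and
  \<open>N\<close> for the binomial coefficient. A pattern of rank \<open>r\<close> has at most
  \<open>(N * growth h ^ r) ^ n\<close> pairs, each with at most \<open>D ^ (n - r)\<close>
  colliding weights. Since \<open>growth h ^ n \<le> D / (2 * K)\<close>, the product is at most
  \<open>N ^ n * D ^ n / (2 * K) ^ r\<close>, and \<open>r \<ge> 1\<close>.\<close>

lemma sum_collisions_pattern:
  assumes D: "real (d ^ m) \<ge> 2 * real (card (column_patterns h)) * growth h ^ n"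
  shows "(\<Sum>p \<in> {p \<in> touching. columns n p = R}. real (card (collisions (fst p) (snd p))))
    \<le> real ((2 * h) choose h) ^ n * real (d ^ m) ^ n / (2 * real (card (column_patterns h)))"
proof (cases "{p \<in> touching. columns n p = R} = {}")
  case True
  show ?thesis unfolding True by simp
next
  case False
  let ?Q = "{p \<in> touching. columns n p = R}"
  let ?N = "real ((2 * h) choose h)" and ?D = "real (d ^ m)" and ?K = "real (card (column_patterns h))"
  have K: "?K > 0" using card_column_patterns_pos by simp
  from False obtain p where p: "p \<in> touching" "columns n p = R" by auto
  obtain i where i: "i < 2 * h" "R \<subseteq> sum_zero ({..<2 * h} - {i})"
    using columns_touching(1)[OF p(1)] p(2) by auto
  have finR: "finite R" and cR: "card R \<le> n"
    using p(2) card_image_le[of "{..<n}"] by (auto simp: columns_def)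
  obtain B where B: "B \<subseteq> R" "fvs.independent B" "R \<subseteq> fvs.span B"
    and le: "real (card {(a, b) \<in> balanced_sets h \<times> balanced_sets h. diff_vec a b \<in> R}) \<le> ?N * growth h ^ card B"
    using card_diff_vec_le_growth[OF h i(1) finR i(2)] by auto
  define r where "r = card B"
  have "B \<noteq> {}" using B(3) columns_touching(2)[OF p(1)] p(2) by auto
  then have r1: "1 \<le> r" using B(1) finR finite_subset by (auto simp: r_def Suc_le_eq card_gt_0_iff)
  have rn: "r \<le> n" using card_mono[OF finR B(1)] cR by (simp add: r_def)
  have \<mu>: "growth h \<ge> 1" using growth_ge[OF h] by simp
  have "card ?Q \<le> card {p \<in> edge_funs h n \<times> edge_funs h n. columns n p = R}"
  proof (rule card_mono)
    show "finite {p \<in> edge_funs h n \<times> edge_funs h n. columns n p = R}"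
      using finite_edge_funs by simp
    show "?Q \<subseteq> {p \<in> edge_funs h n \<times> edge_funs h n. columns n p = R}"
      by (auto simp: touching_def)
  qed
  also have "\<dots> \<le> card {(a, b) \<in> balanced_sets h \<times> balanced_sets h. diff_vec a b \<in> R} ^ n"
    by (rule card_pairs_with_columns)
  finally have "real (card ?Q) \<le> real (card {(a, b) \<in> balanced_sets h \<times> balanced_sets h. diff_vec a b \<in> R}) ^ n"
    unfolding of_nat_power[symmetric] by (rule of_nat_mono)
  also have "\<dots> \<le> (?N * growth h ^ r) ^ n" using le by (intro power_mono) (auto simp: r_def)
  finally have cQ: "real (card ?Q) \<le> (?N * growth h ^ r) ^ n" .
  have "(\<Sum>p \<in> ?Q. real (card (collisions (fst p) (snd p)))) \<le> (\<Sum>p \<in> ?Q. ?D ^ (n - r))"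
  proof (rule sum_mono)
    fix p assume "p \<in> ?Q"
    then have "card (collisions (fst p) (snd p)) \<le> (d ^ m) ^ (n - card B)"
      unfolding collisions_def
      using B by (intro card_hash_collisions) (auto simp: touching_def columns_def)
    then show "real (card (collisions (fst p) (snd p))) \<le> ?D ^ (n - r)"
      unfolding r_def of_nat_power[symmetric] of_nat_le_iff .
  qed
  also have "\<dots> = real (card ?Q) * ?D ^ (n - r)" by simp
  also have "\<dots> \<le> (?N * growth h ^ r) ^ n * ?D ^ (n - r)" using cQ by (intro mult_right_mono) auto
  also have "\<dots> = ?N ^ n * ((growth h ^ n) ^ r * ?D ^ (n - r))"
    by (simp add: power_mult_distrib power_mult[symmetric] mult.commute)
  also have "\<dots> \<le> ?N ^ n * ((?D / (2 * ?K)) ^ r * ?D ^ (n - r))"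
    using D K \<mu> by (intro mult_left_mono mult_right_mono power_mono) (auto simp: field_simps)
  also have "\<dots> = ?N ^ n * (?D ^ n * (1 / (2 * ?K)) ^ r)"
  proof -
    have "?D ^ n = ?D ^ r * ?D ^ (n - r)" using rn by (simp add: power_add[symmetric])
    then show ?thesis by (simp add: power_divide)
  qed
  also have "\<dots> \<le> ?N ^ n * (?D ^ n * (1 / (2 * ?K)) ^ 1)"
  proof -
    have "?K \<ge> 1" using card_column_patterns_pos[of h] by simp
    then show ?thesis using r1 by (intro mult_left_mono power_decreasing) auto
  qed
  finally show ?thesis by simp
qed

lemma finite_touching: "finite touching"
  by (rule finite_subset[of _ "edge_funs h n \<times> edge_funs h n"])
     (auto simp: touching_def finite_edge_funs)

lemma sum_collisions:
  assumes D: "real (d ^ m) \<ge> 2 * real (card (column_patterns h)) * growth h ^ n"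
  shows "(\<Sum>p \<in> touching. real (card (collisions (fst p) (snd p))))
    \<le> real ((2 * h) choose h) ^ n * real (d ^ m) ^ n / 2"
proof -
  let ?K = "real (card (column_patterns h))"
  let ?X = "real ((2 * h) choose h) ^ n * real (d ^ m) ^ n"
  have "(\<Sum>p \<in> touching. real (card (collisions (fst p) (snd p)))) =
    (\<Sum>R \<in> column_patterns h. \<Sum>p \<in> {p \<in> touching. columns n p = R}. real (card (collisions (fst p) (snd p))))"
    using finite_touching finite_column_patterns columns_touching(3)
    by (intro sum.group[symmetric]) auto
  also have "\<dots> \<le> (\<Sum>R \<in> column_patterns h. ?X / (2 * ?K))"
    by (intro sum_mono sum_collisions_pattern D)
  also have "\<dots> = ?X / 2" using card_column_patterns_pos[of h] by simp
  finally show ?thesis .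
qed

text \<open>Averaging over all weights and shifts. By double counting, touching pairs of survivors
  total at most half of the lower bound for the total number of survivors, so some choice keeps the
  other half, on average, as isolated edges.\<close>

lemma exists_large_isolated:
  assumes D: "real (d ^ m) \<ge> 2 * real (card (column_patterns h)) * growth h ^ n"
  shows "\<exists>w u. real ((2 * h) choose h) ^ n * real (card targets) / 2
    \<le> real (card (isolated w u)) * real ((((n + 1) * d) ^ m) ^ (2 * h - 1))"
proof (rule ccontr)
  let ?X = "weights \<times> shifts"
  let ?N = "real ((2 * h) choose h) ^ n" and ?D = "real (d ^ m) ^ n"
  let ?iso = "\<lambda>p. real (card (isolated (fst p) (snd p)))"
  let ?S = "\<lambda>p. surviving (fst p) (snd p)"
  assume "\<not> ?thesis"
  then have small: "?iso p * real (card shifts) < ?N * real (card targets) / 2" for p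
    unfolding card_shifts not_ex not_le by blast
  have finX: "finite ?X" using finite_weights finite_shifts by simp
  have cX: "real (card ?X) = ?D * real (card shifts)"
    by (simp only: card_cartesian_product card_weights of_nat_mult of_nat_power)
  have "card ?X > 0"
    unfolding card_cartesian_product card_weights card_shifts using d by simp
  then have neX: "?X \<noteq> {}" by (metis card.empty less_irrefl)
  have "?N * (?D * real (card targets)) = (\<Sum>E \<in> edge_funs h n. real (card weights * card targets))"
    by (simp only: sum_constant card_edge_funs card_weights of_nat_mult of_nat_power)
  also have "\<dots> \<le> (\<Sum>E \<in> edge_funs h n. real (card {p \<in> ?X. E \<in> ?S p}))"
    by (intro sum_mono of_nat_mono card_hashes_surviving)
  also have "\<dots> = real (\<Sum>E \<in> edge_funs h n. card {p \<in> ?X. E \<in> ?S p})" by simp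
  also have "(\<Sum>E \<in> edge_funs h n. card {p \<in> ?X. E \<in> ?S p}) = (\<Sum>p \<in> ?X. card {E \<in> edge_funs h n. E \<in> ?S p})"
    by (rule sum_multicount_gen[OF finite_edge_funs finX]) auto
  also have "real \<dots> = (\<Sum>p \<in> ?X. real (card (?S p)))"
    unfolding of_nat_sum by (intro sum.cong arg_cong[where f = "\<lambda>A. real (card A)"]) (auto simp: surviving_def)
  also have "\<dots> \<le> (\<Sum>p \<in> ?X. ?iso p + real (card {q \<in> touching. fst q \<in> ?S p \<and> snd q \<in> ?S p}))"
    unfolding of_nat_add[symmetric] by (intro sum_mono of_nat_mono card_surviving_le_isolated)
  also have "\<dots> = (\<Sum>p \<in> ?X. ?iso p) + real (\<Sum>p \<in> ?X. card {q \<in> touching. fst q \<in> ?S p \<and> snd q \<in> ?S p})"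
    by (simp add: sum.distrib)
  also have "(\<Sum>p \<in> ?X. card {q \<in> touching. fst q \<in> ?S p \<and> snd q \<in> ?S p})
     = (\<Sum>q \<in> touching. card {p \<in> ?X. fst q \<in> ?S p \<and> snd q \<in> ?S p})"
    by (rule sum_multicount_gen[OF finX finite_touching]) auto
  also have "real \<dots> \<le> (\<Sum>q \<in> touching. real (card (collisions (fst q) (snd q))) * real (card targets))"
    unfolding of_nat_sum of_nat_mult[symmetric]
    by (intro sum_mono of_nat_mono card_hashes_touching) auto
  also have "\<dots> = (\<Sum>q \<in> touching. real (card (collisions (fst q) (snd q)))) * real (card targets)"
    by (simp add: sum_distrib_right)
  also have "\<dots> \<le> ?N * ?D / 2 * real (card targets)"
    by (intro mult_right_mono sum_collisions D) auto
  finally have "?N * ?D * real (card targets) / 2 \<le> (\<Sum>p \<in> ?X. ?iso p)" by simp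
  then have "?N * ?D * real (card targets) / 2 * real (card shifts) \<le> (\<Sum>p \<in> ?X. ?iso p * real (card shifts))"
    unfolding sum_distrib_right[symmetric] by (intro mult_right_mono) auto
  also have "\<dots> < (\<Sum>p \<in> ?X. ?N * real (card targets) / 2)"
    using small by (intro sum_strict_mono finX neX) auto
  also have "\<dots> = ?N * ?D * real (card targets) / 2 * real (card shifts)"
    by (simp only: sum_constant cX) simp
  finally show False by simp
qed

end

subsection \<open>Kronecker powers of the balanced graph\<close>

text \<open>Replaces the recursion by a condition on each position separately, the form in which
  edges become elements of \<open>edge_funs\<close>.\<close>

lemma edges_kron_power:
  assumes G: "is_kgraph k G"
  shows "e \<in> edges (kron_power G n) \<longleftrightarrow>
    length e = k \<and> (\<forall>x \<in> set e. length x = n) \<and> (\<forall>j<n. map (\<lambda>x. x ! j) e \<in> edges G)"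
proof (induction n arbitrary: e)
  case 0
  show ?case using G by (auto simp: is_kgraph_def intro: replicate_eqI)
next
  case (Suc n)
  have len: "length a = k" if "a \<in> edges G" for a
  proof -
    have "a \<in> listset (verts G)" "arity G = k" using that G by (auto simp: is_kgraph_def)
    then show ?thesis by (auto simp: in_listset_iff dest: list_all2_lengthD)
  qed
  have "e \<in> edges (kron_power G (Suc n)) \<longleftrightarrow>
    (\<exists>a b. a \<in> edges G \<and> b \<in> edges (kron_power G n) \<and> e = map (\<lambda>(x, xs). x # xs) (zip a b))"
    by (auto simp: relabel_def kron_def)
  also have "\<dots> \<longleftrightarrow> length e = k \<and> (\<forall>x \<in> set e. length x = Suc n) \<and>
      (\<forall>j<Suc n. map (\<lambda>x. x ! j) e \<in> edges G)" (is "?L \<longleftrightarrow> ?R")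
  proof
    assume ?L
    then obtain a b where ab: "a \<in> edges G" "b \<in> edges (kron_power G n)"
      "e = map (\<lambda>(x, xs). x # xs) (zip a b)" by auto
    have b: "length b = k" "\<forall>x \<in> set b. length x = n" "\<forall>j<n. map (\<lambda>x. x ! j) b \<in> edges G"
      using ab(2) Suc.IH[of b] by auto
    have a: "length a = k" using len[OF ab(1)] .
    have e: "length e = k" using a b ab(3) by simp
    have ei: "e ! i = a ! i # b ! i" if "i < k" for i using that a b ab(3) by simp
    have "map (\<lambda>x. x ! 0) e = a" using e a ei by (intro nth_equalityI) auto
    moreover have "map (\<lambda>x. x ! Suc j) e = map (\<lambda>x. x ! j) b" for j
      using e b ei by (intro nth_equalityI) auto
    ultimately have "map (\<lambda>x. x ! j) e \<in> edges G" if "j < Suc n" for j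
      using that b ab(1) by (cases j) auto
    moreover have "length x = Suc n" if "x \<in> set e" for x
      using that e ei b by (metis in_set_conv_nth length_Cons)
    ultimately show ?R using e by blast
  next
    assume R: ?R
    define a where "a = map (\<lambda>x. x ! 0) e"
    define b where "b = map tl e"
    have ne: "x = x ! 0 # tl x" if "x \<in> set e" for x
      using R that by (cases x) auto
    have "a \<in> edges G" using R by (simp add: a_def)
    moreover have "b \<in> edges (kron_power G n)"
    proof (subst Suc.IH, intro conjI ballI allI impI)
      show "length b = k" using R by (simp add: b_def)
      show "length x = n" if "x \<in> set b" for x using R that by (auto simp: b_def)
      show "map (\<lambda>x. x ! j) b \<in> edges G" if "j < n" for j
      proof -
        have "map (\<lambda>x. x ! j) b = map (\<lambda>x. x ! Suc j) e"
          unfolding b_def map_map using R that by (intro map_cong) (auto simp: nth_tl)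
        then show ?thesis using R that by simp
      qed
    qed
    moreover have "e = map (\<lambda>(x, xs). x # xs) (zip a b)"
      unfolding a_def b_def using ne
      by (intro nth_equalityI) auto
    ultimately show ?L by blast
  qed
  finally show ?case .
qed

section \<open>Translation between edges and set-valued functions\<close>

definition encode_edge :: "nat \<Rightarrow> nat \<Rightarrow> (nat \<Rightarrow> nat set) \<Rightarrow> nat list list" where
  "encode_edge h n E = map (\<lambda>i. map (\<lambda>j. if i \<in> E j then 2 else 1) [0..<n]) [0..<2 * h]"

lemma length_encode_edge: "length (encode_edge h n E) = 2 * h"
  by (simp add: encode_edge_def)

lemma count_list_map_upt: "count_list (map f [0..<k]) y = card {i. i < k \<and> f i = y}"
proof -
  have "{i. i < length (map f [0..<k]) \<and> y = map f [0..<k] ! i} = {i. i < k \<and> f i = y}" by auto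
  then show ?thesis by (simp add: count_list_eq_length_filter length_filter_conv_card)
qed

lemma encode_edge_nth_eq_iff:
  assumes "i < 2 * h"
  shows "encode_edge h n E ! i = encode_edge h n E' ! i \<longleftrightarrow> same_vertex n i E E'"
  using assms by (auto simp: encode_edge_def same_vertex_def split: if_splits)

lemma inj_on_encode_edge: "inj_on (encode_edge h n) (edge_funs h n)"
proof (rule inj_onI)
  fix E E' assume E: "E \<in> edge_funs h n" "E' \<in> edge_funs h n" and eq: "encode_edge h n E = encode_edge h n E'"
  show "E = E'"
  proof (rule edge_funs_eqI[OF E])
    fix j assume j: "j < n"
    have "i \<in> E j \<longleftrightarrow> i \<in> E' j" if "i < 2 * h" for i
      using encode_edge_nth_eq_iff[OF that, of n E E'] eq j by (auto simp: same_vertex_def)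
    moreover have "E j \<subseteq> {..<2 * h}" "E' j \<subseteq> {..<2 * h}"
      using E j by (auto simp: edge_funs_def balanced_sets_def PiE_iff Ball_def)
    ultimately show "E j = E' j" by blast
  qed
qed

lemma encode_edge_column:
  "j < n \<Longrightarrow> map (\<lambda>x. x ! j) (encode_edge h n E) = map (\<lambda>i. if i \<in> E j then 2 else 1) [0..<2 * h]"
  by (simp add: encode_edge_def)

lemma encode_edge_in_edges:
  assumes "E \<in> edge_funs h n"
  shows "encode_edge h n E \<in> edges (kron_power (balanced_kgraph (2 * h)) n)"
proof -
  have "map (\<lambda>i. if i \<in> E j then 2 else 1) [0..<2 * h] \<in> edges (balanced_kgraph (2 * h))" if "j < n" for j
  proof -
    have Ej: "E j \<subseteq> {..<2 * h}" "card (E j) = h"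
      using assms that by (auto simp: edge_funs_def balanced_sets_def PiE_iff Ball_def)
    have "{i. i < 2 * h \<and> (if i \<in> E j then 2 else 1 :: nat) = 2} = E j"
      "{i. i < 2 * h \<and> (if i \<in> E j then 2 else 1 :: nat) = 1} = {..<2 * h} - E j"
      using Ej by auto
    moreover have "card ({..<2 * h} - E j) = h"
      using Ej by (simp add: card_Diff_subset finite_subset)
    ultimately show ?thesis
      using Ej by (simp add: balanced_kgraph_def count_list_map_upt in_listset_iff list_all2_conv_all_nth)
  qed
  then show ?thesis
    unfolding edges_kron_power[OF is_kgraph_balanced]
    by (auto simp: encode_edge_column) (auto simp: encode_edge_def)
qed

lemma edges_subset_encode:
  assumes e: "e \<in> edges (kron_power (balanced_kgraph (2 * h)) n)"
  shows "\<exists>E \<in> edge_funs h n. e = encode_edge h n E"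
proof -
  note e' = e[unfolded edges_kron_power[OF is_kgraph_balanced]]
  define E where "E = (\<lambda>j\<in>{..<n}. {i. i < 2 * h \<and> e ! i ! j = 2})"
  have col: "map (\<lambda>x. x ! j) e \<in> edges (balanced_kgraph (2 * h))" if "j < n" for j using e' that by auto
  have len: "length e = 2 * h" using e' by auto
  have eq: "map (\<lambda>x. x ! j) e = map (\<lambda>i. e ! i ! j) [0..<2 * h]" for j
    using len by (intro nth_equalityI) auto
  have "E j \<in> balanced_sets h" if "j < n" for j
    using col[OF that] that unfolding eq
    by (auto simp: E_def balanced_sets_def balanced_kgraph_def count_list_map_upt)
  then have "E \<in> edge_funs h n" unfolding edge_funs_def by (intro PiE_I) (auto simp: E_def)
  moreover have "e = encode_edge h n E"
  proof (rule nth_equalityI)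
    show "length e = length (encode_edge h n E)" by (simp add: len encode_edge_def)
    fix i assume i: "i < length e"
    then have li: "length (e ! i) = n" using e' by auto
    show "e ! i = encode_edge h n E ! i"
    proof (rule nth_equalityI)
      show "length (e ! i) = length (encode_edge h n E ! i)" using i len li by (simp add: encode_edge_def)
      fix j assume "j < length (e ! i)"
      then have j: "j < n" using li by simp
      have "e ! i ! j \<in> {1, 2}"
        using col[OF j] i len unfolding eq
        by (auto simp: balanced_kgraph_def in_listset_iff list_all2_conv_all_nth)
      then show "e ! i ! j = encode_edge h n E ! i ! j"
        using i len j by (auto simp: encode_edge_def E_def)
    qed
  qed
  ultimately show ?thesis by blast
qed

text \<open>The hypotheses \<open>ind\<close> and \<open>mat\<close> are \<open>induced\<close> and
  \<open>matching\<close> read through \<open>encode_edge\<close>, which is injective and turns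
  \<open>same_vertex\<close> into equality of entries.\<close>

lemma card_le_subrank:
  assumes h: "h \<ge> 1" and sub: "\<Psi> \<subseteq> edge_funs h n"
    and ind: "\<And>E. E \<in> edge_funs h n \<Longrightarrow> (\<And>i. i < 2 * h \<Longrightarrow> \<exists>E'\<in>\<Psi>. same_vertex n i E E') \<Longrightarrow> E \<in> \<Psi>"
    and mat: "\<And>E E' i. E \<in> \<Psi> \<Longrightarrow> E' \<in> \<Psi> \<Longrightarrow> E \<noteq> E' \<Longrightarrow> i < 2 * h \<Longrightarrow> \<not> same_vertex n i E E'"
  shows "card \<Psi> \<le> subrank (kron_power (balanced_kgraph (2 * h)) n)"
proof -
  let ?G = "kron_power (balanced_kgraph (2 * h)) n"
  let ?X = "encode_edge h n ` \<Psi>"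
  have G: "is_kgraph (2 * h) ?G" by (intro is_kgraph_kron_power is_kgraph_balanced)
  then have ar: "arity ?G = 2 * h" by (simp add: is_kgraph_def)
  have X: "?X \<subseteq> edges ?G" using sub encode_edge_in_edges by blast
  have "edges ?G \<inter> listset (map (\<lambda>i. proj i ?X) [0..<2 * h]) \<subseteq> ?X"
  proof
    fix e assume e: "e \<in> edges ?G \<inter> listset (map (\<lambda>i. proj i ?X) [0..<2 * h])"
    then obtain E where E: "E \<in> edge_funs h n" "e = encode_edge h n E" using edges_subset_encode by blast
    have "\<exists>E'\<in>\<Psi>. same_vertex n i E E'" if i: "i < 2 * h" for i
    proof -
      have "e ! i \<in> proj i ?X" using e i by (auto simp: in_listset_iff list_all2_conv_all_nth)
      then obtain E' where "E' \<in> \<Psi>" "e ! i = encode_edge h n E' ! i" by (auto simp: proj_def)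
      then show ?thesis using encode_edge_nth_eq_iff[OF i, of n E E'] E(2) by auto
    qed
    then show "e \<in> ?X" using ind[OF E(1)] E(2) by blast
  qed
  moreover have "?X \<subseteq> listset (map (\<lambda>i. proj i ?X) [0..<2 * h])"
    by (auto simp: in_listset_iff list_all2_conv_all_nth proj_def length_encode_edge)
  ultimately have "induced ?G ?X" using X unfolding induced_def ar by blast
  moreover have "matching ?G ?X"
    unfolding matching_def ar
  proof (intro ballI impI allI)
    fix a b i assume "a \<in> ?X" "b \<in> ?X" "a \<noteq> b" and i: "i < 2 * h"
    then obtain E E' where "a = encode_edge h n E" "b = encode_edge h n E'" "E \<in> \<Psi>" "E' \<in> \<Psi>" "E \<noteq> E'"
      by auto
    then show "a ! i \<noteq> b ! i" using mat[of E E' i] encode_edge_nth_eq_iff[OF i] i by simp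
  qed
  ultimately have "card ?X \<le> subrank ?G" using subrank_attained(2)[OF G _ X] h by simp
  then show ?thesis using inj_on_subset[OF inj_on_encode_edge sub] by (simp add: card_image)
qed

text \<open>Distinct edges of a matching differ at player 0, whose vertices are words of length
  \<open>n\<close> over two letters.\<close>

lemma subrank_le:
  assumes h: "h \<ge> 1"
  shows "subrank (kron_power (balanced_kgraph (2 * h)) n) \<le> 2 ^ n"
proof -
  let ?G = "kron_power (balanced_kgraph (2 * h)) n"
  have G: "is_kgraph (2 * h) ?G" by (intro is_kgraph_kron_power is_kgraph_balanced)
  then have ar: "arity ?G = 2 * h" by (simp add: is_kgraph_def)
  obtain \<Psi> where \<Psi>: "\<Psi> \<subseteq> edges ?G" "matching ?G \<Psi>" "card \<Psi> = subrank ?G"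
    using subrank_attained(1)[OF G] h by auto
  have inj: "inj_on (\<lambda>e. e ! 0) \<Psi>"
    using \<Psi>(2) h unfolding matching_def ar by (intro inj_onI) (metis less_le_trans mult_pos_pos zero_less_numeral zero_less_one)
  have sub: "(\<lambda>e. e ! 0) ` \<Psi> \<subseteq> {xs. set xs \<subseteq> {1, 2} \<and> length xs = n}"
  proof
    fix x assume "x \<in> (\<lambda>e. e ! 0) ` \<Psi>"
    then obtain E where "x = encode_edge h n E ! 0" using edges_subset_encode \<Psi>(1) by blast
    then show "x \<in> {xs. set xs \<subseteq> {1, 2} \<and> length xs = n}" using h by (auto simp: encode_edge_def)
  qed
  have "card \<Psi> \<le> card {xs. set xs \<subseteq> {1, 2::nat} \<and> length xs = n}"
    by (rule card_inj_on_le[OF inj sub]) (rule finite_lists_length_eq, simp)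
  also have "\<dots> = 2 ^ n" by (subst card_lists_length_eq) (simp_all add: numeral_2_eq_2)
  finally show ?thesis using \<Psi>(3) by simp
qed

section \<open>Choice of parameters and the limit\<close>

text \<open>The sphere holds at least the share \<open>1 / (m * d\<^sup>2 + 1)\<close> of the box.
  Up to that loss it cancels one of the \<open>2 * h - 1\<close> factors \<open>d ^ m\<close> coming
  from the shifts and leaves \<open>2 * h - 2\<close>, the exponent in the definition of
  \<open>growth\<close>.\<close>

lemma subrank_hashing_bound:
  assumes h: "h \<ge> 3" and d: "d \<ge> 1" and m: "m \<ge> 1"
    and D: "real d ^ m \<ge> 2 * real (card (column_patterns h)) * growth h ^ n"
  shows "real ((2 * h) choose h) ^ n \<le>
    real (subrank (kron_power (balanced_kgraph (2 * h)) n)) *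
    (4 * real m * (real d)\<^sup>2 * (real n + 1) ^ (m * (2 * h - 1)) * (real d ^ m) ^ (2 * h - 2))"
proof -
  let ?N = "real ((2 * h) choose h) ^ n" and ?a = "real (subrank (kron_power (balanced_kgraph (2 * h)) n))"
  obtain \<rho> where \<rho>: "d ^ m \<le> card (sphere_section m d \<rho>) * (m * d\<^sup>2 + 1)"
    using large_sphere_section by blast
  interpret hashing h n m d \<rho> using h d by unfold_locales
  obtain w u where wu: "?N * real (card targets) / 2
    \<le> real (card (isolated w u)) * real ((((n + 1) * d) ^ m) ^ (2 * h - 1))"
    using exists_large_isolated D by auto
  have "card (isolated w u) \<le> subrank (kron_power (balanced_kgraph (2 * h)) n)"
  proof (rule card_le_subrank)
    show "isolated w u \<subseteq> edge_funs h n" by (auto simp: isolated_def surviving_def)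
  qed (use h isolated_induced isolated_matching in auto)
  then have "?N * real (card targets) / 2 \<le> ?a * real ((((n + 1) * d) ^ m) ^ (2 * h - 1))"
    using wu by (meson mult_right_mono of_nat_0_le_iff of_nat_mono order_trans)
  also have "real ((((n + 1) * d) ^ m) ^ (2 * h - 1)) = (real n + 1) ^ (m * (2 * h - 1)) * (real d ^ m) ^ (2 * h - 1)"
    by (simp only: of_nat_power of_nat_mult of_nat_add of_nat_1 power_mult_distrib power_mult)
  finally have 1: "?N * real (card targets) \<le> 2 * ?a * ((real n + 1) ^ (m * (2 * h - 1)) * (real d ^ m) ^ (2 * h - 1))"
    by simp
  have "real d ^ m \<le> real (card targets) * (real m * (real d)\<^sup>2 + 1)"
    using of_nat_mono[OF \<rho>, where 'a = real] by (simp add: algebra_simps)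
  also have "\<dots> \<le> real (card targets) * (2 * (real m * (real d)\<^sup>2))"
  proof -
    have "1 * 1 \<le> real m * (real d)\<^sup>2" using m d by (intro mult_mono) auto
    then show ?thesis by (intro mult_left_mono) auto
  qed
  finally have "?N * real d ^ m \<le> ?N * (real (card targets) * (2 * (real m * (real d)\<^sup>2)))"
    by (intro mult_left_mono) auto
  also have "\<dots> = (?N * real (card targets)) * (2 * (real m * (real d)\<^sup>2))" by simp
  also have "\<dots> \<le> (2 * ?a * ((real n + 1) ^ (m * (2 * h - 1)) * (real d ^ m) ^ (2 * h - 1))) * (2 * (real m * (real d)\<^sup>2))"
    by (intro mult_right_mono 1) auto
  also have "(real d ^ m) ^ (2 * h - 1) = (real d ^ m) ^ (2 * h - 2) * real d ^ m"
  proof -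
    have "2 * h - 1 = Suc (2 * h - 2)" using h by simp
    then show ?thesis by simp
  qed
  finally have "?N * real d ^ m \<le> (?a * (4 * real m * (real d)\<^sup>2 * (real n + 1) ^ (m * (2 * h - 1)) * (real d ^ m) ^ (2 * h - 2))) * real d ^ m"
    by (simp add: mult_ac)
  moreover have "real d ^ m > 0" using d by simp
  ultimately show ?thesis by (rule mult_right_le_imp_le)
qed

text \<open>With \<open>d ^ m\<close> within a constant of \<open>growth h ^ n\<close>, the factor
  \<open>(d ^ m) ^ (2 * h - 2)\<close> is at most a constant times \<open>(N / 2) ^ n\<close> and
  turns \<open>N ^ n\<close> into \<open>2 ^ n\<close>. The only exponential loss is
  \<open>d\<^sup>2\<close>, with a base that tends to 1 as \<open>m\<close> grows.\<close>

lemma subrank_lower_bound: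
  assumes h: "h \<ge> 3" and m: "m \<ge> 1"
  shows "\<exists>C p. C > 0 \<and> (\<forall>n. 2 ^ n \<le> real (subrank (kron_power (balanced_kgraph (2 * h)) n)) *
    (C * (real n + 1) ^ p * ((root m (growth h))\<^sup>2) ^ n))"
proof -
  define K where "K = real (card (column_patterns h))"
  define \<mu> where "\<mu> = growth h"
  define \<theta> where "\<theta> = root m \<mu>"
  define p where "p = m * (2 * h - 1)"
  define C where "C = 4 * real m * (4 * (root m (2 * K))\<^sup>2) * (2 ^ m * (2 * K)) ^ (2 * h - 2)"
  define N where "N = real ((2 * h) choose h)"
  have K: "K \<ge> 1" using card_column_patterns_pos[of h] by (simp add: K_def)
  have \<mu>: "\<mu> \<ge> 1" using growth_ge[OF h] by (simp add: \<mu>_def)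
  have \<theta>: "\<theta> > 0" "\<theta> ^ m = \<mu>" using \<mu> m by (auto simp: \<theta>_def)
  have Npos: "N > 0" unfolding N_def by (simp add: zero_less_binomial)
  have "root m (2 * K) > 0" using K m by simp
  then have Cpos: "C > 0" unfolding C_def using m K by simp
  have "2 ^ n \<le> real (subrank (kron_power (balanced_kgraph (2 * h)) n)) * (C * (real n + 1) ^ p * (\<theta>\<^sup>2) ^ n)" for n
  proof -
    let ?a = "real (subrank (kron_power (balanced_kgraph (2 * h)) n))"
    \<comment> \<open>\<open>s ^ m\<close> is exactly the threshold \<open>2 * K * \<mu> ^ n\<close>
      required of \<open>d ^ m\<close>; as \<open>s \<ge> 1\<close>, rounding up costs at most a
      factor 2.\<close>
    define s where "s = root m (2 * K) * \<theta> ^ n"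
    have sm: "s ^ m = 2 * K * \<mu> ^ n"
      unfolding s_def power_mult_distrib using K m \<theta>(2)
      by (simp add: power_mult[symmetric] mult.commute[of n m]) (simp add: power_mult)
    have s0: "s \<ge> 0" unfolding s_def using K \<theta> by (intro mult_nonneg_nonneg real_root_ge_zero) auto
    have "1 * 1 \<le> 2 * K * \<mu> ^ n" using K \<mu> by (intro mult_mono) auto
    then have "1 ^ m \<le> s ^ m" using sm by simp
    then have s1: "s \<ge> 1" using s0 m by (metis power_mono_iff zero_le_one less_le_trans zero_less_one)
    define d where "d = nat \<lceil>s\<rceil>"
    have d: "s \<le> real d" "real d \<le> 2 * s" "d \<ge> 1"
      using s1 unfolding d_def by linarith+
    have "2 * K * \<mu> ^ n \<le> real d ^ m" unfolding sm[symmetric] using d s0 by (intro power_mono) auto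
    then have main: "N ^ n \<le> ?a * (4 * real m * (real d)\<^sup>2 * (real n + 1) ^ p * (real d ^ m) ^ (2 * h - 2))"
      using subrank_hashing_bound[OF h d(3) m, of n] by (simp add: K_def \<mu>_def N_def p_def)
    have d2: "(real d)\<^sup>2 \<le> 4 * (root m (2 * K))\<^sup>2 * (\<theta>\<^sup>2) ^ n"
    proof -
      have "(real d)\<^sup>2 \<le> (2 * s)\<^sup>2" using d by (intro power_mono) auto
      also have "\<dots> = 4 * (root m (2 * K))\<^sup>2 * (\<theta>\<^sup>2) ^ n"
        by (simp add: s_def power_mult_distrib power_mult[symmetric] mult.commute)
      finally show ?thesis .
    qed
    have dm: "(real d ^ m) ^ (2 * h - 2) \<le> (2 ^ m * (2 * K)) ^ (2 * h - 2) * (N / 2) ^ n"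
    proof -
      have "real d ^ m \<le> (2 * s) ^ m" using d by (intro power_mono) auto
      also have "\<dots> = 2 ^ m * (2 * K) * \<mu> ^ n" by (simp add: power_mult_distrib sm)
      finally have "(real d ^ m) ^ (2 * h - 2) \<le> (2 ^ m * (2 * K) * \<mu> ^ n) ^ (2 * h - 2)"
        by (intro power_mono) auto
      also have "\<dots> = (2 ^ m * (2 * K)) ^ (2 * h - 2) * (\<mu> ^ (2 * h - 2)) ^ n"
        by (simp only: power_mult_distrib power_mult[symmetric] mult.commute[of n])
      also have "\<mu> ^ (2 * h - 2) = N / 2" using growth_power[of h] h by (simp add: \<mu>_def N_def)
      finally show ?thesis .
    qed
    have "2 ^ n * (N / 2) ^ n = N ^ n" by (simp add: power_mult_distrib[symmetric])
    also have "\<dots> \<le> ?a * (4 * real m * (real d)\<^sup>2 * (real n + 1) ^ p * (real d ^ m) ^ (2 * h - 2))" by (rule main)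
    also have "\<dots> \<le> ?a * (4 * real m * (4 * (root m (2 * K))\<^sup>2 * (\<theta>\<^sup>2) ^ n) * (real n + 1) ^ p *
        ((2 ^ m * (2 * K)) ^ (2 * h - 2) * (N / 2) ^ n))"
      using d2 dm by (intro mult_mono mult_nonneg_nonneg) auto
    also have "\<dots> = (?a * (C * (real n + 1) ^ p * (\<theta>\<^sup>2) ^ n)) * (N / 2) ^ n"
      unfolding C_def by (simp only: mult_ac)
    finally show ?thesis using Npos by (simp add: mult_le_cancel_right)
  qed
  then show ?thesis using Cpos unfolding \<theta>_def \<mu>_def by blast
qed

text \<open>Order of limits: \<open>m\<close> is fixed first, so that the loss per position is close
  to 1, and then \<open>n\<close> tends to infinity, which removes the constant and the polynomial
  factor.\<close>

lemma root_subrank_tendsto: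
  assumes h: "h \<ge> 3"
  shows "(\<lambda>n. root n (real (subrank (kron_power (balanced_kgraph (2 * h)) n)))) \<longlonglongrightarrow> 2"
proof (rule order_tendstoI)
  let ?a = "\<lambda>n. real (subrank (kron_power (balanced_kgraph (2 * h)) n))"
  have upper: "root n (?a n) \<le> 2" if "n \<ge> 1" for n
  proof -
    have "?a n \<le> 2 ^ n" using of_nat_mono[OF subrank_le[of h n], where 'a = real] h by simp
    then have "root n (?a n) \<le> root n (2 ^ n)" using that by simp
    also have "\<dots> = 2" using that by (simp add: real_root_power_cancel)
    finally show ?thesis .
  qed
  show "\<forall>\<^sub>F n in sequentially. root n (?a n) < y" if "2 < y" for y
    using eventually_ge_at_top[of 1] by eventually_elim (use upper that in fastforce)
  show "\<forall>\<^sub>F n in sequentially. y < root n (?a n)" if y: "y < 2" for y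
  proof -
    have \<mu>: "growth h > 0" using growth_ge[OF h] by simp
    have "(\<lambda>m. 2 / (root m (growth h))\<^sup>2) \<longlonglongrightarrow> 2 / 1\<^sup>2"
      by (intro tendsto_intros LIMSEQ_root_const \<mu>) auto
    then have "\<forall>\<^sub>F m in sequentially. y < 2 / (root m (growth h))\<^sup>2"
      using order_tendstoD(1)[of _ 2 sequentially y] y by simp
    then obtain m where m: "m \<ge> 1" "y < 2 / (root m (growth h))\<^sup>2"
      by (metis (mono_tags, lifting) eventually_sequentially le_cases)
    define \<theta> where "\<theta> = (root m (growth h))\<^sup>2"
    have \<theta>: "\<theta> > 0" using m \<mu> by (simp add: \<theta>_def)
    obtain C p where C: "C > 0"
      and low: "\<And>n. 2 ^ n \<le> ?a n * (C * (real n + 1) ^ p * \<theta> ^ n)"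
      using subrank_lower_bound[OF h m(1)] unfolding \<theta>_def by blast
    \<comment> \<open>The \<open>n\<close>-th root of \<open>C * (2 * n) ^ p\<close>, which
      dominates \<open>C * (n + 1) ^ p\<close> for \<open>n \<ge> 1\<close>; it tends to 1.\<close>
    let ?c = "\<lambda>n. root n (C * 2 ^ p) * root n (real n) ^ p"
    have "(\<lambda>n. 2 / \<theta> / ?c n) \<longlonglongrightarrow> 2 / \<theta> / (1 * 1 ^ p)"
      by (intro tendsto_intros LIMSEQ_root_const LIMSEQ_root) (use C in auto)
    then have "\<forall>\<^sub>F n in sequentially. y < 2 / \<theta> / ?c n"
      using order_tendstoD(1)[of _ "2 / \<theta>" sequentially y] m(2) by (simp add: \<theta>_def)
    then show ?thesis
      using eventually_ge_at_top[of 1]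
    proof eventually_elim
      case (elim n)
      have n: "n > 0" using elim by simp
      have "(real n + 1) ^ p \<le> (2 * real n) ^ p" using elim by (intro power_mono) auto
      then have "C * (real n + 1) ^ p * \<theta> ^ n \<le> C * (2 * real n) ^ p * \<theta> ^ n"
        using C \<theta> by (intro mult_right_mono mult_left_mono) auto
      then have "2 ^ n \<le> ?a n * (C * (2 * real n) ^ p * \<theta> ^ n)"
        using low[of n] by (meson mult_left_mono of_nat_0_le_iff order_trans)
      then have "root n (2 ^ n) \<le> root n (?a n * (C * 2 ^ p * real n ^ p * \<theta> ^ n))"
        using n by (simp add: power_mult_distrib mult_ac)
      then have "2 \<le> root n (?a n) * (?c n * \<theta>)"
        using n \<theta> by (simp add: real_root_mult real_root_power_cancel real_root_power mult_ac)
      moreover have "?c n > 0" using C n by simp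
      ultimately have "2 / \<theta> / ?c n \<le> root n (?a n)"
        using \<theta> by (simp add: field_simps)
      then show ?case using elim(1) by linarith
    qed
  qed
qed

text \<open>Convergence is asserted beside the value of \<open>asymptotic_subrank\<close>, because
  an equation about \<open>lim\<close> alone does not express it.\<close>

theorem theorem1p2:
  "\<exists>k0::nat. \<forall>k\<ge>k0. even k \<longrightarrow>
     asymptotic_subrank (balanced_kgraph k) = 2 \<and>
     (\<lambda>n. root n (real (subrank (kron_power (balanced_kgraph k) n)))) \<longlonglongrightarrow> 2"
proof (intro exI[of _ 6] allI impI)
  fix k :: nat assume "6 \<le> k" "even k"
  \<comment> \<open>The threshold 6 amounts to \<open>h \<ge> 3\<close>, the range in which
    \<open>agree_count_endpoints\<close> is proved.\<close>
  then obtain h where h: "k = 2 * h" "h \<ge> 3" by (auto elim!: evenE)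
  have lim: "(\<lambda>n. root n (real (subrank (kron_power (balanced_kgraph k) n)))) \<longlonglongrightarrow> 2"
    unfolding h(1) by (rule root_subrank_tendsto[OF h(2)])
  then show "asymptotic_subrank (balanced_kgraph k) = 2 \<and>
      (\<lambda>n. root n (real (subrank (kron_power (balanced_kgraph k) n)))) \<longlonglongrightarrow> 2"
    unfolding asymptotic_subrank_def by (simp add: limI)
qed

end
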